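(* Let $\mathcal M$ be a Riemannian manifold, let $\mathcal C\subset\mathcal M$ be strongly convex and let $m\in\mathcal C$. Let $F\colon\mathcal C\to\overline{\mathbb R}$ be proper, and let $f_m\colon T_m\mathcal M\to\overline{\mathbb R}$ be given by $f_m(X)=F(\exp_m X)$ for $X\in\mathcal L_{\mathcal C,m}$ and $f_m(X)=+\infty$ for $X\notin\mathcal L_{\mathcal C,m}$. If $f_m$ is lower semicontinuous and convex on $T_m\mathcal M$, then $F=F_{mm}^{**}$ on $\mathcal C$. In this case $F_m^*$ is proper as well.
   Context: $\mathcal M$ is a connected, finite-dimensional smooth Riemannian manifold with tangent spaces $T_p\mathcal M$, cotangent spaces $T_p^*\mathcal M$, duality pairing $\langle\cdot,\cdot\rangle$ between $T_p^*\mathcal M$ and $T_p\mathcal M$, norm $\|\cdot\|_p$ induced by the metric, Riemannian distance $d$ and exponential map $\exp_p$. $\overline{\mathbb R}=\mathbb R\cup\{\pm\infty\}$. A set $\mathcal C\subset\mathcal M$ is strongly convex if for any $p,q\in\mathcal C$ there is a unique shortest geodesic of $\mathcal M$ connecting $p$ to $q$, and that geodesic lies completely in $\mathcal C$. For $m\in\mathcal C$ let $\mathcal L_{\mathcal C,m}=\{X\in T_m\mathcal M:\exp_m X\in\mathcal C \text{ and } \|X\|_m=d(\exp_m X,m)\}$. If $\mathcal C$ is strongly convex, $\exp_m\colon\mathcal L_{\mathcal C,m}\to\mathcal C$ is a bijection, and $\log_m\colon\mathcal C\to\mathcal L_{\mathcal C,m}$ denotes its inverse. A function is proper if it is not identically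 $+\infty$ and never takes the value $-\infty$. The $m$-Fenchel conjugate of $F\colon\mathcal C\to\overline{\mathbb R}$ is $F_m^*\colon T_m^*\mathcal M\to\overline{\mathbb R}$, $F_m^*(\xi_m)=\sup_{X\in\mathcal L_{\mathcal C,m}}\{\langle\xi_m,X\rangle-F(\exp_m X)\}$. The Fenchel biconjugate is $F_{mm}^{**}(p)=\sup_{\xi_m\in T_m^*\mathcal M}\{\langle\xi_m,\log_m p\rangle-F_m^*(\xi_m)\}$ for $p\in\mathcal C$, with values in $\overline{\mathbb R}$. Convexity and lower semicontinuity of $f_m$ are the usual notions on the vector space $T_m\mathcal M$. *)

theory Defs
  imports "HOL-Analysis.Analysis"
begin

text \<open>
  The manifold is the whole type \<open>'m\<close>; its Hausdorff and second countable topology is given by the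
  type classes, its smooth structure by an atlas of charts with values in the Euclidean space \<open>'e\<close>.
\<close>

primrec Ck_on :: "nat \<Rightarrow> 'a::real_normed_vector set \<Rightarrow> ('a \<Rightarrow> 'b::real_normed_vector) \<Rightarrow> bool" where
  "Ck_on 0 S f \<longleftrightarrow> continuous_on S f"
| "Ck_on (Suc k) S f \<longleftrightarrow>
     (\<forall>x\<in>S. f differentiable at x) \<and> (\<forall>v. Ck_on k S (\<lambda>x. frechet_derivative f (at x) v))"

text \<open>Only used for open \<open>S\<close>.\<close>

definition smooth_on :: "'a::real_normed_vector set \<Rightarrow> ('a \<Rightarrow> 'b::real_normed_vector) \<Rightarrow> bool" where
  "smooth_on S f \<longleftrightarrow> (\<forall>k. Ck_on k S f)"


section \<open>Riemannian manifolds\<close>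

text \<open>A chart is a pair of its domain and its coordinate map.\<close>

type_synonym ('m, 'e) chart = "'m set \<times> ('m \<Rightarrow> 'e)"

abbreviation chart_inv :: "('m, 'e) chart \<Rightarrow> 'e \<Rightarrow> 'm" where
  "chart_inv \<kappa> \<equiv> inv_into (fst \<kappa>) (snd \<kappa>)"

definition is_chart :: "('m::topological_space, 'e::euclidean_space) chart \<Rightarrow> bool" where
  "is_chart \<kappa> \<longleftrightarrow> open (fst \<kappa>) \<and> open (snd \<kappa> ` fst \<kappa>) \<and>
     homeomorphism (fst \<kappa>) (snd \<kappa> ` fst \<kappa>) (snd \<kappa>) (chart_inv \<kappa>)"

abbreviation transition :: "('m, 'e) chart \<Rightarrow> ('m, 'e) chart \<Rightarrow> 'e \<Rightarrow> 'e" where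
  "transition \<kappa> \<kappa>' \<equiv> snd \<kappa>' \<circ> chart_inv \<kappa>"

definition smooth_atlas :: "('m::topological_space, 'e::euclidean_space) chart set \<Rightarrow> bool" where
  "smooth_atlas A \<longleftrightarrow> (\<forall>\<kappa>\<in>A. is_chart \<kappa>) \<and> (\<Union>\<kappa>\<in>A. fst \<kappa>) = UNIV \<and>
     (\<forall>\<kappa>\<in>A. \<forall>\<kappa>'\<in>A. smooth_on (snd \<kappa> ` (fst \<kappa> \<inter> fst \<kappa>')) (transition \<kappa> \<kappa>'))"

text \<open>
  A tangent vector at \<open>p\<close> is the family of its coordinate representations in all charts around \<open>p\<close>;
  these transform under the differentials of the chart transitions. The value at charts not
  containing \<open>p\<close> is normalised to \<open>0\<close>. Vector space operations are pointwise.
\<close>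

type_synonym ('m, 'e) tvec = "('m, 'e) chart \<Rightarrow> 'e"

record ('m, 'e) riem_structure =
  atlas :: "('m, 'e) chart set"
  metric :: "'m \<Rightarrow> ('m, 'e) tvec \<Rightarrow> ('m, 'e) tvec \<Rightarrow> real"

definition charts_at :: "('m, 'e) riem_structure \<Rightarrow> 'm \<Rightarrow> ('m, 'e) chart set" where
  "charts_at M p = {\<kappa> \<in> atlas M. p \<in> fst \<kappa>}"

definition tangent_space ::
    "('m::topological_space, 'e::euclidean_space) riem_structure \<Rightarrow> 'm \<Rightarrow> ('m, 'e) tvec set" where
  "tangent_space M p = {X.
     (\<forall>\<kappa>. \<kappa> \<notin> charts_at M p \<longrightarrow> X \<kappa> = 0) \<and>
     (\<forall>\<kappa>\<in>charts_at M p. \<forall>\<kappa>'\<in>charts_at M p.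
        X \<kappa>' = frechet_derivative (transition \<kappa> \<kappa>') (at (snd \<kappa> p)) (X \<kappa>))}"

definition lincomb ::
    "real \<Rightarrow> ('m, 'e::euclidean_space) tvec \<Rightarrow> real \<Rightarrow> ('m, 'e) tvec \<Rightarrow> ('m, 'e) tvec" where
  "lincomb a X b Y = (\<lambda>\<kappa>. a *\<^sub>R X \<kappa> + b *\<^sub>R Y \<kappa>)"

text \<open>The tangent vector at \<open>p\<close> whose coordinate representation in the chart \<open>\<kappa>\<close> is \<open>u\<close>.\<close>

definition tvec_of_coord ::
    "('m::topological_space, 'e::euclidean_space) riem_structure \<Rightarrow> 'm \<Rightarrow> ('m, 'e) chart \<Rightarrow> 'e
       \<Rightarrow> ('m, 'e) tvec" where
  "tvec_of_coord M p \<kappa> u = (\<lambda>\<kappa>'. if \<kappa>' \<in> charts_at M p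
     then frechet_derivative (transition \<kappa> \<kappa>') (at (snd \<kappa> p)) u else 0)"

text \<open>The coordinate representation of the metric in the chart \<open>\<kappa>\<close>, at \<open>x \<in> snd \<kappa> ` fst \<kappa>\<close>.\<close>

definition metric_in ::
    "('m::topological_space, 'e::euclidean_space) riem_structure \<Rightarrow> ('m, 'e) chart
       \<Rightarrow> 'e \<Rightarrow> 'e \<Rightarrow> 'e \<Rightarrow> real" where
  "metric_in M \<kappa> x u v = metric M (chart_inv \<kappa> x)
     (tvec_of_coord M (chart_inv \<kappa> x) \<kappa> u) (tvec_of_coord M (chart_inv \<kappa> x) \<kappa> v)"

definition inner_product_on_tangent ::
    "('m::topological_space, 'e::euclidean_space) riem_structure \<Rightarrow> 'm \<Rightarrow> bool" where
  "inner_product_on_tangent M p \<longleftrightarrow>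
     (\<forall>X\<in>tangent_space M p. \<forall>Y\<in>tangent_space M p. metric M p X Y = metric M p Y X) \<and>
     (\<forall>X\<in>tangent_space M p. \<forall>Y\<in>tangent_space M p. \<forall>Z\<in>tangent_space M p. \<forall>a b.
        metric M p (lincomb a X b Y) Z = a * metric M p X Z + b * metric M p Y Z) \<and>
     (\<forall>X\<in>tangent_space M p. X \<noteq> (\<lambda>_. 0) \<longrightarrow> metric M p X X > 0)"

definition connected_riemannian_manifold ::
    "('m::{t2_space,second_countable_topology}, 'e::euclidean_space) riem_structure \<Rightarrow> bool" where
  "connected_riemannian_manifold M \<longleftrightarrow>
     connected (UNIV :: 'm set) \<and> smooth_atlas (atlas M) \<and>
     (\<forall>p. inner_product_on_tangent M p) \<and>
     (\<forall>\<kappa>\<in>atlas M. \<forall>u v. smooth_on (snd \<kappa> ` fst \<kappa>) (\<lambda>x. metric_in M \<kappa> x u v))"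

definition tnorm ::
    "('m::topological_space, 'e::euclidean_space) riem_structure \<Rightarrow> 'm \<Rightarrow> ('m, 'e) tvec \<Rightarrow> real" where
  "tnorm M p X = sqrt (metric M p X X)"


section \<open>Curves, length and distance\<close>

text \<open>All curves are parametrised over \<open>{0..1}\<close>; values outside that interval are irrelevant.\<close>

definition velocity ::
    "('m::topological_space, 'e::euclidean_space) riem_structure \<Rightarrow> (real \<Rightarrow> 'm) \<Rightarrow> real \<Rightarrow> ('m, 'e) tvec"
  where
  "velocity M \<gamma> t = (\<lambda>\<kappa>. if \<kappa> \<in> charts_at M (\<gamma> t)
     then vector_derivative (snd \<kappa> \<circ> \<gamma>) (at t within {0..1}) else 0)"

definition C1_curve_on ::
    "('m::topological_space, 'e::euclidean_space) riem_structure \<Rightarrow> real \<Rightarrow> real \<Rightarrow> (real \<Rightarrow> 'm) \<Rightarrow> bool"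
  where
  "C1_curve_on M a b \<gamma> \<longleftrightarrow> continuous_on {a..b} \<gamma> \<and>
     (\<forall>t\<in>{a..b}. \<forall>\<kappa>\<in>charts_at M (\<gamma> t).
        (snd \<kappa> \<circ> \<gamma>) differentiable (at t within {a..b}) \<and>
        continuous (at t within {a..b})
          (\<lambda>s. vector_derivative (snd \<kappa> \<circ> \<gamma>) (at s within {a..b})))"

text \<open>
  Each piece is continuously differentiable up to its end points, in contrast to
  \<^term>\<open>(piecewise_C1_differentiable_on)\<close>. Hence the speed is bounded and integrable.
\<close>

definition piecewise_C1_curve ::
    "('m::topological_space, 'e::euclidean_space) riem_structure \<Rightarrow> (real \<Rightarrow> 'm) \<Rightarrow> bool" where
  "piecewise_C1_curve M \<gamma> \<longleftrightarrow>
     (\<exists>(n::nat) \<tau>. \<tau> 0 = 0 \<and> \<tau> n = 1 \<and>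
        (\<forall>i<n. \<tau> i < \<tau> (Suc i) \<and> C1_curve_on M (\<tau> i) (\<tau> (Suc i)) \<gamma>))"

definition curve_length ::
    "('m::topological_space, 'e::euclidean_space) riem_structure \<Rightarrow> (real \<Rightarrow> 'm) \<Rightarrow> real" where
  "curve_length M \<gamma> = integral {0..1} (\<lambda>t. tnorm M (\<gamma> t) (velocity M \<gamma> t))"

definition riem_dist ::
    "('m::topological_space, 'e::euclidean_space) riem_structure \<Rightarrow> 'm \<Rightarrow> 'm \<Rightarrow> real" where
  "riem_dist M p q = Inf {curve_length M \<gamma> | \<gamma>. piecewise_C1_curve M \<gamma> \<and> \<gamma> 0 = p \<and> \<gamma> 1 = q}"


section \<open>Geodesics and the exponential map\<close>

text \<open>The Christoffel symbols of the first kind of the Levi-Civita connection.\<close>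

definition christoffel1 ::
    "('m::topological_space, 'e::euclidean_space) riem_structure \<Rightarrow> ('m, 'e) chart
       \<Rightarrow> 'e \<Rightarrow> 'e \<Rightarrow> 'e \<Rightarrow> 'e \<Rightarrow> real" where
  "christoffel1 M \<kappa> x u v w =
     (frechet_derivative (\<lambda>y. metric_in M \<kappa> y v w) (at x) u
      + frechet_derivative (\<lambda>y. metric_in M \<kappa> y u w) (at x) v
      - frechet_derivative (\<lambda>y. metric_in M \<kappa> y u v) (at x) w) / 2"

text \<open>
  In every chart the coordinate curve \<open>c\<close> is twice differentiable (one-sidedly at \<open>0\<close> and \<open>1\<close>) and
  its covariant acceleration, with coordinates \<open>c'' + \<Gamma>(c', c')\<close>, vanishes; here this vector is
  tested against every \<open>w\<close> using the metric, which turns \<open>\<Gamma>\<close> into the symbols of the first kind.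
  Smoothness of \<open>c\<close> follows from the equation. Geodesics are thus affinely parametrised.
\<close>

definition geodesic ::
    "('m::topological_space, 'e::euclidean_space) riem_structure \<Rightarrow> (real \<Rightarrow> 'm) \<Rightarrow> bool" where
  "geodesic M \<gamma> \<longleftrightarrow> continuous_on {0..1} \<gamma> \<and>
     (\<forall>t\<in>{0..1}. \<forall>\<kappa>\<in>charts_at M (\<gamma> t).
        let c = snd \<kappa> \<circ> \<gamma>; c' = (\<lambda>s. vector_derivative c (at s within {0..1})) in
          c differentiable (at t within {0..1}) \<and>
          (\<exists>a. (c' has_vector_derivative a) (at t within {0..1}) \<and>
             (\<forall>w. metric_in M \<kappa> (c t) a w + christoffel1 M \<kappa> (c t) (c' t) (c' t) w = 0)))"

definition shortest_geodesic ::
    "('m::topological_space, 'e::euclidean_space) riem_structure \<Rightarrow> 'm \<Rightarrow> 'm \<Rightarrow> (real \<Rightarrow> 'm) \<Rightarrow> bool"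
  where
  "shortest_geodesic M p q \<gamma> \<longleftrightarrow>
     geodesic M \<gamma> \<and> \<gamma> 0 = p \<and> \<gamma> 1 = q \<and> curve_length M \<gamma> = riem_dist M p q"

definition strongly_convex ::
    "('m::topological_space, 'e::euclidean_space) riem_structure \<Rightarrow> 'm set \<Rightarrow> bool" where
  "strongly_convex M C \<longleftrightarrow>
     (\<forall>p\<in>C. \<forall>q\<in>C. \<exists>\<gamma>. shortest_geodesic M p q \<gamma> \<and> \<gamma> ` {0..1} \<subseteq> C \<and>
        (\<forall>\<gamma>'. shortest_geodesic M p q \<gamma>' \<longrightarrow> (\<forall>t\<in>{0..1}. \<gamma>' t = \<gamma> t)))"

text \<open>The manifold need not be complete, so the exponential map may be partial.\<close>

definition exp_domain ::
    "('m::topological_space, 'e::euclidean_space) riem_structure \<Rightarrow> 'm \<Rightarrow> ('m, 'e) tvec set" where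
  "exp_domain M m = {X \<in> tangent_space M m. \<exists>\<gamma>. geodesic M \<gamma> \<and> \<gamma> 0 = m \<and> velocity M \<gamma> 0 = X}"

definition riem_exp ::
    "('m::topological_space, 'e::euclidean_space) riem_structure \<Rightarrow> 'm \<Rightarrow> ('m, 'e) tvec \<Rightarrow> 'm" where
  "riem_exp M m X = (THE p. \<exists>\<gamma>. geodesic M \<gamma> \<and> \<gamma> 0 = m \<and> velocity M \<gamma> 0 = X \<and> \<gamma> 1 = p)"

definition log_range ::
    "('m::topological_space, 'e::euclidean_space) riem_structure \<Rightarrow> 'm set \<Rightarrow> 'm \<Rightarrow> ('m, 'e) tvec set"
  where
  "log_range M C m = {X \<in> exp_domain M m.
     riem_exp M m X \<in> C \<and> tnorm M m X = riem_dist M (riem_exp M m X) m}"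

definition riem_log ::
    "('m::topological_space, 'e::euclidean_space) riem_structure \<Rightarrow> 'm set \<Rightarrow> 'm \<Rightarrow> 'm \<Rightarrow> ('m, 'e) tvec"
  where
  "riem_log M C m = the_inv_into (log_range M C m) (riem_exp M m)"


section \<open>Fenchel conjugates\<close>

text \<open>Linear functionals on the tangent space, extended by \<open>0\<close>; the pairing is application.\<close>

definition cotangent_space ::
    "('m::topological_space, 'e::euclidean_space) riem_structure \<Rightarrow> 'm \<Rightarrow> (('m, 'e) tvec \<Rightarrow> real) set"
  where
  "cotangent_space M p = {\<xi>.
     (\<forall>X. X \<notin> tangent_space M p \<longrightarrow> \<xi> X = 0) \<and>
     (\<forall>X\<in>tangent_space M p. \<forall>Y\<in>tangent_space M p. \<forall>a b.
        \<xi> (lincomb a X b Y) = a * \<xi> X + b * \<xi> Y)}"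

definition proper_on :: "'a set \<Rightarrow> ('a \<Rightarrow> ereal) \<Rightarrow> bool" where
  "proper_on S f \<longleftrightarrow> (\<exists>x\<in>S. f x \<noteq> \<infinity>) \<and> (\<forall>x\<in>S. f x \<noteq> -\<infinity>)"

definition fenchel_conjugate ::
    "('m::topological_space, 'e::euclidean_space) riem_structure \<Rightarrow> 'm set \<Rightarrow> 'm \<Rightarrow> ('m \<Rightarrow> ereal)
       \<Rightarrow> (('m, 'e) tvec \<Rightarrow> real) \<Rightarrow> ereal" where
  "fenchel_conjugate M C m F \<xi> = (SUP X\<in>log_range M C m. ereal (\<xi> X) - F (riem_exp M m X))"

definition fenchel_biconjugate ::
    "('m::topological_space, 'e::euclidean_space) riem_structure \<Rightarrow> 'm set \<Rightarrow> 'm \<Rightarrow> ('m \<Rightarrow> ereal)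
       \<Rightarrow> 'm \<Rightarrow> ereal" where
  "fenchel_biconjugate M C m F p =
     (SUP \<xi>\<in>cotangent_space M m. ereal (\<xi> (riem_log M C m p)) - fenchel_conjugate M C m F \<xi>)"

definition tangent_pullback ::
    "('m::topological_space, 'e::euclidean_space) riem_structure \<Rightarrow> 'm set \<Rightarrow> 'm \<Rightarrow> ('m \<Rightarrow> ereal)
       \<Rightarrow> ('m, 'e) tvec \<Rightarrow> ereal" where
  "tangent_pullback M C m F X = (if X \<in> log_range M C m then F (riem_exp M m X) else \<infinity>)"

text \<open>
  Since \<^term>\<open>\<infinity> + (-\<infinity>) = (\<infinity>::ereal)\<close>, this is convexity of the epigraph also for improper functions.
\<close>

definition convex_on_tangent ::
    "('m::topological_space, 'e::euclidean_space) riem_structure \<Rightarrow> 'm \<Rightarrow> (('m, 'e) tvec \<Rightarrow> ereal)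
       \<Rightarrow> bool" where
  "convex_on_tangent M m f \<longleftrightarrow>
     (\<forall>X\<in>tangent_space M m. \<forall>Y\<in>tangent_space M m. \<forall>t\<in>{0<..<1}.
        f (lincomb (1 - t) X t Y) \<le> ereal (1 - t) * f X + ereal t * f Y)"

definition lsc_on_tangent ::
    "('m::topological_space, 'e::euclidean_space) riem_structure \<Rightarrow> 'm \<Rightarrow> (('m, 'e) tvec \<Rightarrow> ereal)
       \<Rightarrow> bool" where
  "lsc_on_tangent M m f \<longleftrightarrow>
     (\<forall>X\<in>tangent_space M m. \<forall>a<f X. \<exists>\<delta>>0. \<forall>Y\<in>tangent_space M m.
        tnorm M m (lincomb 1 Y (-1) X) < \<delta> \<longrightarrow> a < f Y)"

end

theory Submission
  imports Defs
begin

text \<open>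
  The statement is the Fenchel--Moreau theorem on the vector space \<open>T\<^sub>m M\<close>, transported to \<open>C\<close>
  along \<open>exp\<^sub>m\<close>. Two things have to be supplied.

  First, \<open>exp\<^sub>m\<close> must map \<^const>\<open>log_range\<close> bijectively onto \<open>C\<close>
  (\<open>bij_betw_riem_exp\<close>). It is well defined because a geodesic is determined by its initial position
  and velocity (\<open>geodesic_unique\<close>): in a chart, positivity of the metric makes the acceleration a
  locally Lipschitz function of position and velocity (\<open>acceleration_lipschitz\<close>), Gronwall's argument
  gives uniqueness near each instant, and connectedness of the unit interval does the rest. A geodesic
  has constant speed (\<open>geodesic_constant_speed\<close>), so that its length is the norm of its initial
  velocity; hence \<open>X\<close> lies in \<^const>\<open>log_range\<close> precisely when the geodesic with initial velocity
  \<open>X\<close> ends in \<open>C\<close> and, run backwards, is a shortest geodesic from that end point to \<open>m\<close>.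
  Existence and uniqueness of the shortest geodesic from \<open>p\<close> to \<open>m\<close> then become
  surjectivity and injectivity. The reversal reconciles \<^const>\<open>log_range\<close>, which measures the
  distance from \<open>p\<close> to \<open>m\<close>, with geodesics starting at \<open>m\<close>.

  Secondly, a proper convex lower semicontinuous function \<open>f\<close> on \<open>T\<^sub>m M\<close> is the supremum of
  its affine minorants (\<open>tangent_affine_minorant\<close>). A chart at \<open>m\<close> identifies \<open>T\<^sub>m M\<close>
  with Euclidean space, where the point \<open>(X, r)\<close> below the graph of \<open>f\<close> is separated from the
  closed convex epigraph by a hyperplane (\<open>affine_minorant\<close>).

  An affine minorant \<open>\<xi> - \<beta>\<close> of \<open>f\<^sub>m\<close> is the same thing as a bound
  \<open>F\<^sup>*(\<xi>) \<le> \<beta>\<close>, so every \<open>r < F p\<close> is a lower bound of the biconjugate at \<open>p\<close>; the other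
  inequality is that of Fenchel and Young. The existence of one minorant, and of one point where
  \<open>F\<close> is finite, makes the conjugate proper.
\<close>

section \<open>Affine minorants of convex functions\<close>

lemma epigraph_convex:
  fixes g :: "'a::real_vector \<Rightarrow> ereal"
  assumes "\<And>x y t. t \<in> {0<..<1::real} \<Longrightarrow>
      g ((1 - t) *\<^sub>R x + t *\<^sub>R y) \<le> ereal (1 - t) * g x + ereal t * g y"
  shows "convex {z :: 'a \<times> real. g (fst z) \<le> ereal (snd z)}"
proof (rule convexI, clarsimp)
  fix x y :: 'a and r s u v :: real
  assume *: "g x \<le> ereal r" "g y \<le> ereal s" "0 \<le> u" "0 \<le> v" "u + v = 1"
  consider "u = 0" | "v = 0" | "0 < u" "0 < v" using *(3,4) by linarith
  then show "g (u *\<^sub>R x + v *\<^sub>R y) \<le> ereal (u * r + v * s)"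
  proof cases
    case 3
    then have v: "v \<in> {0<..<1}" "u = 1 - v" using *(5) by auto
    have "g (u *\<^sub>R x + v *\<^sub>R y) \<le> ereal u * g x + ereal v * g y"
      using assms[OF v(1)] v(2) by simp
    also have "\<dots> \<le> ereal u * ereal r + ereal v * ereal s"
      using * by (intro add_mono ereal_mult_left_mono) auto
    finally show ?thesis by simp
  qed (use * in auto)
qed

lemma epigraph_closed:
  fixes g :: "'a::metric_space \<Rightarrow> ereal"
  assumes "\<And>x a. a < g x \<Longrightarrow> \<exists>\<delta>>0. \<forall>y. dist y x < \<delta> \<longrightarrow> a < g y"
  shows "closed {z :: 'a \<times> real. g (fst z) \<le> ereal (snd z)}"
proof -
  have "open {z :: 'a \<times> real. ereal (snd z) < g (fst z)}"
  proof (subst open_subopen, intro ballI)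
    fix z :: "'a \<times> real"
    assume "z \<in> {z. ereal (snd z) < g (fst z)}"
    then obtain x r where z: "z = (x, r)" "ereal r < g x" by (cases z) auto
    then obtain a where a: "r < a" "ereal a < g x"
      using ereal_dense2 by (metis ereal_less_ereal_Ex less_ereal.simps(1))
    then obtain \<delta> where \<delta>: "\<delta> > 0" "\<And>y. dist y x < \<delta> \<Longrightarrow> ereal a < g y" using assms by blast
    have sub: "ball x \<delta> \<times> {..<a} \<subseteq> {z. ereal (snd z) < g (fst z)}"
    proof clarsimp
      fix y s assume "dist x y < \<delta>" "s < a"
      then have "ereal s < ereal a" "ereal a < g y" using \<delta>(2) by (simp_all add: dist_commute)
      then show "ereal s < g y" by (rule less_trans)
    qed
    show "\<exists>T. open T \<and> z \<in> T \<and> T \<subseteq> {z. ereal (snd z) < g (fst z)}"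
      by (rule exI[of _ "ball x \<delta> \<times> {..<a}"]) (use sub a \<delta>(1) z(1) in \<open>simp add: open_Times\<close>)
  qed
  then show ?thesis
    by (simp add: closed_def Compl_eq not_le)
qed

text \<open>
  The point \<open>(x0, r)\<close> lies strictly below the epigraph, so a hyperplane separates the two. A
  hyperplane that is not vertical is the graph of the minorant. A vertical one can occur when
  \<open>g x0 = \<infinity>\<close>; then it is added, with a large factor, to a minorant obtained from the
  point \<open>x1\<close>, where \<open>g\<close> is finite and no vertical hyperplane can separate.
\<close>

lemma affine_minorant:
  fixes g :: "'a::euclidean_space \<Rightarrow> ereal"
  assumes conv: "\<And>x y t. t \<in> {0<..<1::real} \<Longrightarrow>
      g ((1 - t) *\<^sub>R x + t *\<^sub>R y) \<le> ereal (1 - t) * g x + ereal t * g y"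
    and lsc: "\<And>x a. a < g x \<Longrightarrow> \<exists>\<delta>>0. \<forall>y. dist y x < \<delta> \<longrightarrow> a < g y"
    and proper: "\<And>x. g x \<noteq> -\<infinity>" "g x1 \<noteq> \<infinity>"
    and r: "ereal r < g x0"
  obtains \<xi> \<beta> where "\<And>y. ereal (\<xi> \<bullet> y - \<beta>) \<le> g y" "r < \<xi> \<bullet> x0 - \<beta>"
proof -
  define E where "E = {z :: 'a \<times> real. g (fst z) \<le> ereal (snd z)}"
  have E: "convex E" "closed E"
    unfolding E_def using epigraph_convex[OF conv] epigraph_closed[OF lsc] by auto
  have sep: "\<exists>\<alpha> \<tau> b. \<alpha> \<bullet> x + \<tau> * s < b \<and> 0 \<le> \<tau> \<and> (\<forall>y t. g y \<le> ereal t \<longrightarrow> b < \<alpha> \<bullet> y + \<tau> * t)"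
    if "ereal s < g x" for x s
  proof -
    have "(x, s) \<notin> E" using that by (simp add: E_def)
    from separating_hyperplane_closed_point[OF E this] obtain c b
      where c: "c \<bullet> (x, s) < b" "\<And>z. z \<in> E \<Longrightarrow> b < c \<bullet> z" by blast
    obtain \<alpha> \<tau> where [simp]: "c = (\<alpha>, \<tau>)" by (cases c)
    have above: "b < \<alpha> \<bullet> y + \<tau> * t" if "g y \<le> ereal t" for y t
      using c(2)[of "(y, t)"] that by (simp add: E_def)
    obtain s1 where s1: "g x1 = ereal s1" using proper by (cases "g x1") auto
    \<comment> \<open>The epigraph contains all points above \<open>(x1, s1)\<close>, so the hyperplane cannot lean downwards.\<close>
    have "0 \<le> \<tau>"
    proof (rule ccontr)
      assume neg: "\<not> 0 \<le> \<tau>"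
      define A where "A = \<alpha> \<bullet> x1 + \<tau> * s1 - b"
      have "A > 0" using above[of x1 s1] s1 by (simp add: A_def)
      then have "b < \<alpha> \<bullet> x1 + \<tau> * (s1 - A / \<tau>)"
        using neg by (intro above) (simp add: s1 divide_less_0_iff less_imp_le)
      moreover have "\<tau> * (s1 - A / \<tau>) = \<tau> * s1 - A" using neg by (simp add: right_diff_distrib)
      ultimately show False by (simp add: A_def)
    qed
    then show ?thesis using above c(1) by auto
  qed
  have graph: "\<exists>\<xi> \<beta>. (\<forall>y. ereal (\<xi> \<bullet> y - \<beta>) \<le> g y) \<and> s < \<xi> \<bullet> x - \<beta>"
    if "\<tau> > 0" "\<alpha> \<bullet> x + \<tau> * s < b" "\<forall>y t. g y \<le> ereal t \<longrightarrow> b < \<alpha> \<bullet> y + \<tau> * t"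
    for \<alpha> \<tau> b x s
  proof (intro exI conjI allI)
    fix y
    show "ereal ((- (1 / \<tau>) *\<^sub>R \<alpha>) \<bullet> y - (- b / \<tau>)) \<le> g y"
    proof (cases "g y")
      case (real t)
      then have "b < \<alpha> \<bullet> y + \<tau> * t" using that(3) by simp
      then show ?thesis using real that(1) by (simp add: field_simps)
    qed (use proper in auto)
    show "s < (- (1 / \<tau>) *\<^sub>R \<alpha>) \<bullet> x - (- b / \<tau>)" using that(1,2) by (simp add: field_simps)
  qed
  have "\<exists>\<xi> \<beta>. (\<forall>y. ereal (\<xi> \<bullet> y - \<beta>) \<le> g y) \<and> r < \<xi> \<bullet> x0 - \<beta>"
  proof -
    obtain \<alpha> \<tau> b where sp: "\<alpha> \<bullet> x0 + \<tau> * r < b" "0 \<le> \<tau>"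
      "\<forall>y t. g y \<le> ereal t \<longrightarrow> b < \<alpha> \<bullet> y + \<tau> * t" using sep[OF r] by blast
    show ?thesis
    proof (cases "\<tau> = 0")
      case False
      then show ?thesis using graph[of \<tau> \<alpha> x0 r b] sp by auto
    next
      case True
      obtain s1 where s1: "g x1 = ereal s1" using proper by (cases "g x1") auto
      \<comment> \<open>The points \<open>(x1, s1)\<close> and \<open>(x1, s1 - 1)\<close> lie on different sides of the hyperplane,
        so it is not vertical.\<close>
      have "ereal (s1 - 1) < g x1" by (simp add: s1)
      from sep[OF this] obtain \<alpha>' \<tau>' b' where sp': "\<alpha>' \<bullet> x1 + \<tau>' * (s1 - 1) < b'" "0 \<le> \<tau>'"
        "\<forall>y t. g y \<le> ereal t \<longrightarrow> b' < \<alpha>' \<bullet> y + \<tau>' * t" by blast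
      have "b' < \<alpha>' \<bullet> x1 + \<tau>' * s1" using sp'(3) s1 by simp
      with sp'(1,2) have "\<tau>' > 0" by (cases "\<tau>' = 0") auto
      from graph[OF this sp'(1,3)] obtain \<xi> \<beta>
        where mi: "\<And>y. ereal (\<xi> \<bullet> y - \<beta>) \<le> g y" by blast
      \<comment> \<open>Tilting by a large multiple of the vertical hyperplane lifts the minorant above \<open>r\<close> at \<open>x0\<close>.\<close>
      define h where "h = b - \<alpha> \<bullet> x0"
      have h: "h > 0" using sp(1) True by (simp add: h_def)
      define n where "n = (\<bar>r - (\<xi> \<bullet> x0 - \<beta>)\<bar> + 1) / h"
      have n: "n \<ge> 0" "n * h = \<bar>r - (\<xi> \<bullet> x0 - \<beta>)\<bar> + 1" using h by (auto simp: n_def)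
      show ?thesis
      proof (intro exI conjI allI)
        fix y
        show "ereal ((\<xi> - n *\<^sub>R \<alpha>) \<bullet> y - (\<beta> - n * b)) \<le> g y"
        proof (cases "g y")
          case (real t)
          then have "b < \<alpha> \<bullet> y" "\<xi> \<bullet> y - \<beta> \<le> t"
            using sp(3)[rule_format, of y t] True mi[of y] by auto
          then have "n * b \<le> n * (\<alpha> \<bullet> y)" using n by (intro mult_left_mono) auto
          then show ?thesis using real \<open>\<xi> \<bullet> y - \<beta> \<le> t\<close> by (simp add: inner_diff_left)
        qed (use proper in auto)
        show "r < (\<xi> - n *\<^sub>R \<alpha>) \<bullet> x0 - (\<beta> - n * b)"
          using n(2) unfolding h_def by (simp add: inner_diff_left algebra_simps abs_if split: if_splits)
      qed
    qed
  qed
  then show thesis using that by blast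
qed

section \<open>Multilinear forms and locally Lipschitz functions\<close>

text \<open>
  This and the next two lemmas bound a form by its coefficients. Applied to the difference of the
  forms at two points, they turn Lipschitz continuity of finitely many coefficient functions into an
  estimate that is uniform in the arguments of the form.
\<close>

lemma abs_linear_le:
  fixes f :: "'a::euclidean_space \<Rightarrow> real"
  assumes "linear f"
  shows "\<bar>f u\<bar> \<le> (\<Sum>b\<in>Basis. \<bar>f b\<bar>) * norm u"
proof -
  have "f u = f (\<Sum>b\<in>Basis. (u \<bullet> b) *\<^sub>R b)" by (simp add: euclidean_representation)
  also have "\<dots> = (\<Sum>b\<in>Basis. (u \<bullet> b) * f b)"
    by (simp add: linear_sum[OF assms] linear_scale[OF assms])
  finally have "\<bar>f u\<bar> \<le> (\<Sum>b\<in>Basis. \<bar>(u \<bullet> b) * f b\<bar>)" by (simp add: sum_abs)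
  also have "\<dots> \<le> (\<Sum>b\<in>Basis. \<bar>f b\<bar> * norm u)"
    by (intro sum_mono) (simp add: abs_mult mult.commute[of "\<bar>_ \<bullet> _\<bar>"] mult_left_mono Basis_le_norm)
  finally show ?thesis by (simp add: sum_distrib_right)
qed

lemma abs_bilinear_le:
  fixes h :: "'a::euclidean_space \<Rightarrow> 'a \<Rightarrow> real"
  assumes "\<And>v. linear (\<lambda>u. h u v)" "\<And>u. linear (h u)"
  shows "\<bar>h u v\<bar> \<le> (\<Sum>i\<in>Basis. \<Sum>j\<in>Basis. \<bar>h i j\<bar>) * norm u * norm v"
proof -
  have "\<bar>h u v\<bar> \<le> (\<Sum>i\<in>Basis. \<bar>h i v\<bar>) * norm u" by (rule abs_linear_le[OF assms(1)])
  also have "\<dots> \<le> (\<Sum>i\<in>Basis. (\<Sum>j\<in>Basis. \<bar>h i j\<bar>) * norm v) * norm u"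
    by (intro mult_right_mono sum_mono abs_linear_le assms) auto
  finally show ?thesis by (simp only: sum_distrib_right[symmetric]) (simp add: mult_ac)
qed

lemma abs_trilinear_le:
  fixes h :: "'a::euclidean_space \<Rightarrow> 'a \<Rightarrow> 'a \<Rightarrow> real"
  assumes "\<And>v w. linear (\<lambda>u. h u v w)" "\<And>u w. linear (\<lambda>v. h u v w)" "\<And>u v. linear (h u v)"
  shows "\<bar>h u v w\<bar> \<le> (\<Sum>k\<in>Basis. \<Sum>i\<in>Basis. \<Sum>j\<in>Basis. \<bar>h k i j\<bar>) * norm u * norm v * norm w"
proof -
  have "\<bar>h u v w\<bar> \<le> (\<Sum>k\<in>Basis. \<bar>h k v w\<bar>) * norm u" by (rule abs_linear_le[OF assms(1)])
  also have "\<dots> \<le> (\<Sum>k\<in>Basis. (\<Sum>i\<in>Basis. \<Sum>j\<in>Basis. \<bar>h k i j\<bar>) * norm v * norm w) * norm u"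
    by (intro mult_right_mono sum_mono abs_bilinear_le assms) auto
  finally show ?thesis by (simp only: sum_distrib_right[symmetric]) (simp add: mult_ac)
qed

text \<open>
  The derivative depends continuously on the point in each direction, hence is bounded on a compact
  ball, and the mean value inequality applies.
\<close>

lemma C1_locally_lipschitz:
  fixes f :: "'a::euclidean_space \<Rightarrow> real"
  assumes S: "open S" "x0 \<in> S" and f: "Ck_on (Suc 0) S f"
  shows "\<exists>\<delta>>0. \<exists>L\<ge>0. cball x0 \<delta> \<subseteq> S \<and>
    (\<forall>x\<in>cball x0 \<delta>. \<forall>y\<in>cball x0 \<delta>. \<bar>f x - f y\<bar> \<le> L * dist x y)"
proof -
  define D where "D x = frechet_derivative f (at x)" for x
  obtain \<delta> where \<delta>: "\<delta> > 0" "cball x0 \<delta> \<subseteq> S" using S by (meson open_contains_cball)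
  have der: "(f has_derivative D x) (at x)" if "x \<in> S" for x
    using f that by (simp add: D_def frechet_derivative_works)
  have cont: "continuous_on S (\<lambda>x. D x v)" for v using f by (simp add: D_def)
  have "compact ((\<lambda>x. \<Sum>b\<in>Basis. \<bar>D x b\<bar>) ` cball x0 \<delta>)"
    by (intro compact_continuous_image continuous_intros continuous_on_subset[OF cont \<delta>(2)]) auto
  then obtain L where "\<forall>y\<in>(\<lambda>x. \<Sum>b\<in>Basis. \<bar>D x b\<bar>) ` cball x0 \<delta>. norm y \<le> L"
    using compact_imp_bounded bounded_iff by blast
  then have L: "\<bar>\<Sum>b\<in>Basis. \<bar>D x b\<bar>\<bar> \<le> L" if "x \<in> cball x0 \<delta>" for x
    using imageI[OF that, of "\<lambda>x. \<Sum>b\<in>Basis. \<bar>D x b\<bar>"] by auto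
  have L0: "L \<ge> 0" using \<delta>(1) by (intro order_trans[OF abs_ge_zero L[of x0]]) simp
  have "\<bar>f x - f y\<bar> \<le> L * dist x y" if xy: "x \<in> cball x0 \<delta>" "y \<in> cball x0 \<delta>" for x y
  proof -
    have "norm (f x - f y) \<le> L * norm (x - y)"
    proof (rule differentiable_bound[OF convex_cball _ _ xy])
      fix z assume z: "z \<in> cball x0 \<delta>"
      then have d: "(f has_derivative D z) (at z)" using der \<delta>(2) by auto
      then show "(f has_derivative D z) (at z within cball x0 \<delta>)" by (rule has_derivative_at_withinI)
      show "onorm (D z) \<le> L"
      proof (rule onorm_bound[OF L0])
        fix v
        have "\<bar>D z v\<bar> \<le> (\<Sum>b\<in>Basis. \<bar>D z b\<bar>) * norm v"
          by (rule abs_linear_le[OF has_derivative_linear[OF d]])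
        also have "\<dots> \<le> L * norm v" using L[OF z] by (intro mult_right_mono) auto
        finally show "norm (D z v) \<le> L * norm v" by simp
      qed
    qed
    then show ?thesis by (simp add: dist_norm)
  qed
  then show ?thesis using \<delta> L0 by blast
qed

lemma C1_family_locally_lipschitz:
  fixes f :: "'i \<Rightarrow> 'a::euclidean_space \<Rightarrow> real"
  assumes S: "open S" "x0 \<in> S" and "finite I" and "\<And>i. i \<in> I \<Longrightarrow> Ck_on (Suc 0) S (f i)"
  shows "\<exists>\<delta>>0. \<exists>L\<ge>0. cball x0 \<delta> \<subseteq> S \<and>
    (\<forall>x\<in>cball x0 \<delta>. \<forall>y\<in>cball x0 \<delta>. (\<Sum>i\<in>I. \<bar>f i x - f i y\<bar>) \<le> L * dist x y)"
  using assms(3,4)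
proof induction
  case empty
  obtain \<delta> where \<delta>: "\<delta> > 0" "cball x0 \<delta> \<subseteq> S" using S by (meson open_contains_cball)
  then show ?case by (intro exI[of _ \<delta>] exI[of _ 0]) auto
next
  case (insert j I)
  obtain \<delta> L where a: "\<delta> > 0" "L \<ge> 0" "cball x0 \<delta> \<subseteq> S"
    "\<And>x y. x\<in>cball x0 \<delta> \<Longrightarrow> y\<in>cball x0 \<delta> \<Longrightarrow> (\<Sum>i\<in>I. \<bar>f i x - f i y\<bar>) \<le> L * dist x y"
    using insert by (metis insertCI)
  obtain \<delta>' L' where b: "\<delta>' > 0" "L' \<ge> 0"
    "\<And>x y. x\<in>cball x0 \<delta>' \<Longrightarrow> y\<in>cball x0 \<delta>' \<Longrightarrow> \<bar>f j x - f j y\<bar> \<le> L' * dist x y"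
    using C1_locally_lipschitz[OF S insert.prems[of j]] by auto
  show ?case
  proof (intro exI conjI ballI)
    show "min \<delta> \<delta>' > 0" "L + L' \<ge> 0" "cball x0 (min \<delta> \<delta>') \<subseteq> S" using a b by auto
    fix x y assume "x \<in> cball x0 (min \<delta> \<delta>')" "y \<in> cball x0 (min \<delta> \<delta>')"
    then show "(\<Sum>i\<in>insert j I. \<bar>f i x - f i y\<bar>) \<le> (L + L') * dist x y"
      using a(4)[of x y] b(3)[of x y] insert.hyps by (simp add: distrib_right)
  qed
qed

section \<open>Metrics in coordinates\<close>

text \<open>
  A Riemannian metric on an open set of Euclidean space, which is what the metric looks like in a chart.
\<close>

locale coordinate_metric =
  fixes S :: "'e::euclidean_space set" and G :: "'e \<Rightarrow> 'e \<Rightarrow> 'e \<Rightarrow> real"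
  assumes open_domain: "open S"
    and linear_left: "x \<in> S \<Longrightarrow> linear (\<lambda>u. G x u v)"
    and symmetric: "x \<in> S \<Longrightarrow> G x u v = G x v u"
    and positive: "x \<in> S \<Longrightarrow> u \<noteq> 0 \<Longrightarrow> G x u u > 0"
    and smooth: "smooth_on S (\<lambda>x. G x u v)"
begin

definition dG :: "'e \<Rightarrow> 'e \<Rightarrow> 'e \<Rightarrow> 'e \<Rightarrow> real" where
  "dG x u v w = frechet_derivative (\<lambda>y. G y v w) (at x) u"

definition christoffel :: "'e \<Rightarrow> 'e \<Rightarrow> 'e \<Rightarrow> 'e \<Rightarrow> real" where
  "christoffel x u v w = (dG x u v w + dG x v u w - dG x w u v) / 2"

lemma linear_right: assumes "x \<in> S" shows "linear (G x u)"
proof -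
  have "G x u = (\<lambda>v. G x v u)" by (intro ext symmetric assms)
  then show ?thesis using linear_left[OF assms, of u] by simp
qed

lemma has_derivative_G:
  assumes "x \<in> S" shows "((\<lambda>y. G y v w) has_derivative (\<lambda>u. dG x u v w)) (at x)"
proof -
  have "Ck_on (Suc 0) S (\<lambda>x. G x v w)" using smooth by (simp only: smooth_on_def)
  then show ?thesis using assms by (simp add: dG_def frechet_derivative_works)
qed

lemma Ck_G: "Ck_on (Suc 0) S (\<lambda>x. G x u v)"
  using smooth by (simp only: smooth_on_def)

lemma Ck_dG: "Ck_on (Suc 0) S (\<lambda>x. dG x u v w)"
proof -
  have "Ck_on (Suc (Suc 0)) S (\<lambda>x. G x v w)" using smooth by (simp only: smooth_on_def)
  then show ?thesis by (simp add: dG_def)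
qed

text \<open>
  The algebraic rules for \<^term>\<open>dG\<close> below follow from the corresponding rules for \<open>G\<close>. Those
  hold only on \<open>S\<close>, which suffices because \<open>S\<close> is open.
\<close>

lemma dG_unique:
  assumes "x \<in> S" "((\<lambda>y. f y) has_derivative f') (at x)" "\<And>y. y \<in> S \<Longrightarrow> f y = G y v w"
  shows "dG x u v w = f' u"
proof -
  have "((\<lambda>y. G y v w) has_derivative f') (at x)"
    using has_derivative_transform_within_open[OF assms(2) open_domain assms(1)] assms(3) by simp
  then have "f' = (\<lambda>u. dG x u v w)" using has_derivative_G[OF assms(1)] by (rule has_derivative_unique)
  then show ?thesis by simp
qed

lemma dG_symmetric: "x \<in> S \<Longrightarrow> dG x u v w = dG x u w v"
  by (rule dG_unique[OF _ has_derivative_G]) (auto simp: symmetric)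

lemma linear_dG1: "x \<in> S \<Longrightarrow> linear (\<lambda>u. dG x u v w)"
  by (rule has_derivative_linear[OF has_derivative_G])

lemma linear_dG2: assumes "x \<in> S" shows "linear (\<lambda>v. dG x u v w)"
proof (rule linearI)
  fix v v' show "dG x u (v + v') w = dG x u v w + dG x u v' w"
    by (rule dG_unique[OF assms has_derivative_add[OF has_derivative_G has_derivative_G]])
      (use assms in \<open>auto simp: linear_add[OF linear_left]\<close>)
next
  fix c v
  have "((\<lambda>y. c * G y v w) has_derivative (\<lambda>u. c * dG x u v w)) (at x)"
    by (intro derivative_intros has_derivative_G assms)
  from dG_unique[OF assms this, of "c *\<^sub>R v" w] show "dG x u (c *\<^sub>R v) w = c *\<^sub>R dG x u v w"
    using linear_scale[OF linear_left] by simp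
qed

lemma linear_dG3: assumes "x \<in> S" shows "linear (dG x u v)"
proof -
  have "dG x u v = (\<lambda>w. dG x u w v)" by (intro ext dG_symmetric assms)
  then show ?thesis using linear_dG2[OF assms, of u v] by simp
qed

lemma christoffel_left_symmetric: "x \<in> S \<Longrightarrow> christoffel x u v w = christoffel x v u w"
  by (simp add: christoffel_def dG_symmetric[of x w u v])

lemma christoffel_diff: "x \<in> S \<Longrightarrow> christoffel x (u - u') v w = christoffel x u v w - christoffel x u' v w"
  unfolding christoffel_def
  by (simp add: linear_diff[OF linear_dG1] linear_diff[OF linear_dG2] linear_diff[OF linear_dG3]
      diff_divide_distrib add_divide_distrib)

lemma christoffel_minus: "x \<in> S \<Longrightarrow> christoffel x (- u) (- u) w = christoffel x u u w"
  unfolding christoffel_def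
  by (simp add: linear_neg[OF linear_dG1] linear_neg[OF linear_dG2] linear_neg[OF linear_dG3])

text \<open>
  One radius serves all estimates: \<open>\<mu>\<close> is half the minimum of \<open>G x0\<close> on the unit sphere, and the
  radius is so small that \<open>G\<close> varies by at most that amount.
\<close>

lemma local_bounds:
  assumes "x0 \<in> S"
  obtains \<delta> \<mu> L B where "\<delta> > 0" "\<mu> > 0" "L \<ge> 0" "B \<ge> 0" "cball x0 \<delta> \<subseteq> S"
    "\<And>x u. x \<in> cball x0 \<delta> \<Longrightarrow> \<mu> * (norm u)\<^sup>2 \<le> G x u u"
    "\<And>x y u v. x \<in> cball x0 \<delta> \<Longrightarrow> y \<in> cball x0 \<delta> \<Longrightarrow>
        \<bar>G x u v - G y u v\<bar> \<le> L * dist x y * norm u * norm v"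
    "\<And>x u v w. x \<in> cball x0 \<delta> \<Longrightarrow> \<bar>dG x u v w\<bar> \<le> B * norm u * norm v * norm w"
    "\<And>x y u v w. x \<in> cball x0 \<delta> \<Longrightarrow> y \<in> cball x0 \<delta> \<Longrightarrow>
        \<bar>dG x u v w - dG y u v w\<bar> \<le> L * dist x y * norm u * norm v * norm w"
proof -
  obtain \<delta>1 L1 where 1: "\<delta>1 > 0" "L1 \<ge> 0" "cball x0 \<delta>1 \<subseteq> S"
    "\<And>x y. x\<in>cball x0 \<delta>1 \<Longrightarrow> y\<in>cball x0 \<delta>1 \<Longrightarrow>
        (\<Sum>(i,j)\<in>Basis\<times>Basis. \<bar>G x i j - G y i j\<bar>) \<le> L1 * dist x y"
    using C1_family_locally_lipschitz[OF open_domain assms, of "Basis\<times>Basis" "\<lambda>(i,j) x. G x i j"]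
      Ck_G by (auto simp: case_prod_beta')
  obtain \<delta>2 L2 where 2: "\<delta>2 > 0" "L2 \<ge> 0" "cball x0 \<delta>2 \<subseteq> S"
    "\<And>x y. x\<in>cball x0 \<delta>2 \<Longrightarrow> y\<in>cball x0 \<delta>2 \<Longrightarrow>
        (\<Sum>(k,i,j)\<in>Basis\<times>Basis\<times>Basis. \<bar>dG x k i j - dG y k i j\<bar>) \<le> L2 * dist x y"
    using C1_family_locally_lipschitz[OF open_domain assms, of "Basis\<times>Basis\<times>Basis" "\<lambda>(k,i,j) x. dG x k i j"]
      Ck_dG by (auto simp: case_prod_beta')
  have G_lip: "\<bar>G x u v - G y u v\<bar> \<le> L1 * dist x y * norm u * norm v"
    if xy: "x \<in> cball x0 \<delta>1" "y \<in> cball x0 \<delta>1" for x y u v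
  proof -
    have S: "x \<in> S" "y \<in> S" using xy 1(3) by auto
    have "\<bar>G x u v - G y u v\<bar> \<le> (\<Sum>i\<in>Basis. \<Sum>j\<in>Basis. \<bar>G x i j - G y i j\<bar>) * norm u * norm v"
      by (rule abs_bilinear_le[of "\<lambda>u v. G x u v - G y u v"];
          intro linear_compose_sub linear_left linear_right S)
    also have "\<dots> \<le> L1 * dist x y * norm u * norm v"
      using 1(4)[OF xy] by (intro mult_right_mono) (auto simp: sum.cartesian_product)
    finally show ?thesis .
  qed
  have dG_lip: "\<bar>dG x u v w - dG y u v w\<bar> \<le> L2 * dist x y * norm u * norm v * norm w"
    if xy: "x \<in> cball x0 \<delta>2" "y \<in> cball x0 \<delta>2" for x y u v w
  proof -
    have S: "x \<in> S" "y \<in> S" using xy 2(3) by auto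
    have "\<bar>dG x u v w - dG y u v w\<bar> \<le>
        (\<Sum>k\<in>Basis. \<Sum>i\<in>Basis. \<Sum>j\<in>Basis. \<bar>dG x k i j - dG y k i j\<bar>) * norm u * norm v * norm w"
      by (rule abs_trilinear_le[of "\<lambda>u v w. dG x u v w - dG y u v w"];
          intro linear_compose_sub linear_dG1 linear_dG2 linear_dG3 S)
    also have "\<dots> \<le> L2 * dist x y * norm u * norm v * norm w"
      using 2(4)[OF xy] by (intro mult_right_mono) (auto simp: sum.cartesian_product)
    finally show ?thesis .
  qed
  define B0 where "B0 = (\<Sum>k\<in>Basis. \<Sum>i\<in>Basis. \<Sum>j\<in>Basis. \<bar>dG x0 k i j\<bar>)"
  have B0: "B0 \<ge> 0" unfolding B0_def by (intro sum_nonneg) auto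
  have dG_bound: "\<bar>dG x u v w\<bar> \<le> (B0 + L2 * \<delta>2) * norm u * norm v * norm w"
    if x: "x \<in> cball x0 \<delta>2" for x u v w
  proof -
    have "\<bar>dG x u v w\<bar> \<le> \<bar>dG x0 u v w\<bar> + \<bar>dG x0 u v w - dG x u v w\<bar>" by linarith
    also have "\<dots> \<le> B0 * norm u * norm v * norm w + L2 * \<delta>2 * norm u * norm v * norm w"
    proof (intro add_mono)
      show "\<bar>dG x0 u v w\<bar> \<le> B0 * norm u * norm v * norm w" unfolding B0_def
        by (rule abs_trilinear_le) (intro linear_dG1 linear_dG2 linear_dG3 assms)+
      have "\<bar>dG x0 u v w - dG x u v w\<bar> \<le> L2 * dist x0 x * norm u * norm v * norm w"
        using dG_lip 2(1) x by simp
      also have "\<dots> \<le> L2 * \<delta>2 * norm u * norm v * norm w"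
        using x 2 by (intro mult_right_mono mult_left_mono) auto
      finally show "\<bar>dG x0 u v w - dG x u v w\<bar> \<le> L2 * \<delta>2 * norm u * norm v * norm w" .
    qed
    finally show ?thesis by (simp add: algebra_simps)
  qed
  obtain \<mu> where \<mu>: "\<mu> > 0" "\<And>u. norm u = 1 \<Longrightarrow> \<mu> \<le> G x0 u u"
  proof -
    have bl: "bilinear (G x0)" using assms by (simp add: bilinear_def linear_left linear_right)
    have "continuous_on (sphere 0 1) (\<lambda>u. G x0 u u)"
      by (intro bilinear_continuous_on_compose[OF _ _ bl] continuous_intros)
    then obtain u0 where u0: "u0 \<in> sphere 0 1" "\<forall>u\<in>sphere 0 1. G x0 u0 u0 \<le> G x0 u u"
      using continuous_attains_inf[of "sphere 0 1" "\<lambda>u. G x0 u u"] by auto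
    have "G x0 u0 u0 > 0" using u0(1) by (intro positive[OF assms]) auto
    then show thesis using that[of "G x0 u0 u0"] u0(2) by simp
  qed
  have \<mu>x0: "\<mu> * (norm u)\<^sup>2 \<le> G x0 u u" for u
  proof (cases "u = 0")
    case False
    have "G x0 u u = G x0 (norm u *\<^sub>R (u /\<^sub>R norm u)) (norm u *\<^sub>R (u /\<^sub>R norm u))" using False by simp
    also have "\<dots> = (norm u)\<^sup>2 * G x0 (u /\<^sub>R norm u) (u /\<^sub>R norm u)"
      by (simp only: linear_scale[OF linear_left[OF assms]] linear_scale[OF linear_right[OF assms]])
        (simp add: power2_eq_square)
    finally have *: "G x0 u u = (norm u)\<^sup>2 * G x0 (u /\<^sub>R norm u) (u /\<^sub>R norm u)" .
    have "(norm u)\<^sup>2 * \<mu> \<le> (norm u)\<^sup>2 * G x0 (u /\<^sub>R norm u) (u /\<^sub>R norm u)"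
      using False by (intro mult_left_mono \<mu>(2)) auto
    then show ?thesis by (simp add: * mult.commute)
  qed (simp add: linear_0[OF linear_left[OF assms]])
  define \<delta> where "\<delta> = min (min \<delta>1 \<delta>2) (\<mu> / (2 * (L1 + 1)))"
  have \<delta>: "\<delta> > 0" "\<delta> \<le> \<delta>1" "\<delta> \<le> \<delta>2" "\<delta> \<le> \<mu> / (2 * (L1 + 1))" using 1 2 \<mu> by (auto simp: \<delta>_def)
  have sub: "cball x0 \<delta> \<subseteq> cball x0 \<delta>1" "cball x0 \<delta> \<subseteq> cball x0 \<delta>2" using \<delta> by auto
  have "\<delta> * (2 * (L1 + 1)) \<le> \<mu>" using \<delta>(4) 1(2) by (subst (asm) pos_le_divide_eq) auto
  then have L1\<delta>: "L1 * \<delta> \<le> \<mu> / 2" using \<delta>(1) by (simp add: algebra_simps)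
  show thesis
  proof (rule that[of \<delta> "\<mu> / 2" "L1 + L2" "B0 + L2 * \<delta>2"])
    show "\<delta> > 0" "\<mu> / 2 > 0" "L1 + L2 \<ge> 0" using \<delta> \<mu> 1 2 by auto
    show "B0 + L2 * \<delta>2 \<ge> 0" using B0 2 by simp
    show "cball x0 \<delta> \<subseteq> S" using sub 1 by auto
    show "\<mu> / 2 * (norm u)\<^sup>2 \<le> G x u u" if x: "x \<in> cball x0 \<delta>" for x u
    proof -
      have "\<bar>G x u u - G x0 u u\<bar> \<le> L1 * dist x x0 * norm u * norm u"
        using x sub(1) 1(1) by (intro G_lip) auto
      also have "\<dots> \<le> L1 * \<delta> * norm u * norm u"
        using x 1 by (intro mult_right_mono mult_left_mono) (auto simp: dist_commute)
      also have "\<dots> \<le> \<mu> / 2 * norm u * norm u"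
        using L1\<delta> by (intro mult_right_mono) auto
      finally show ?thesis using \<mu>x0[of u] by (simp add: power2_eq_square mult.assoc) argo
    qed
    show "\<bar>G x u v - G y u v\<bar> \<le> (L1 + L2) * dist x y * norm u * norm v"
      if "x \<in> cball x0 \<delta>" "y \<in> cball x0 \<delta>" for x y u v
    proof -
      have "\<bar>G x u v - G y u v\<bar> \<le> L1 * dist x y * norm u * norm v" using that sub by (intro G_lip) auto
      also have "\<dots> \<le> (L1 + L2) * dist x y * norm u * norm v" using 2 by (intro mult_right_mono) auto
      finally show ?thesis .
    qed
    show "\<bar>dG x u v w - dG y u v w\<bar> \<le> (L1 + L2) * dist x y * norm u * norm v * norm w"
      if "x \<in> cball x0 \<delta>" "y \<in> cball x0 \<delta>" for x y u v w
    proof -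
      have "\<bar>dG x u v w - dG y u v w\<bar> \<le> L2 * dist x y * norm u * norm v * norm w"
        using that sub by (intro dG_lip) auto
      also have "\<dots> \<le> (L1 + L2) * dist x y * norm u * norm v * norm w"
        using 1 by (intro mult_right_mono) auto
      finally show ?thesis .
    qed
    show "\<bar>dG x u v w\<bar> \<le> (B0 + L2 * \<delta>2) * norm u * norm v * norm w" if "x \<in> cball x0 \<delta>" for x u v w
      using that sub by (intro dG_bound) auto
  qed
qed

text \<open>
  The geodesic equation determines the acceleration only implicitly, by its inner products with all
  \<open>w\<close>. Subtracting the equations at the two points and testing with the difference \<open>w = a - b\<close>
  bounds \<open>G x w w\<close>, hence \<open>\<mu> * (norm w)\<^sup>2\<close>, by a multiple of \<open>norm w\<close>.
\<close>

lemma acceleration_lipschitz: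
  assumes "x0 \<in> S" and R: "R \<ge> 0"
  shows "\<exists>\<delta>>0. \<exists>K\<ge>0. \<forall>x\<in>cball x0 \<delta>. \<forall>y\<in>cball x0 \<delta>. \<forall>u v a b.
    norm u \<le> R \<longrightarrow> norm v \<le> R \<longrightarrow> (\<forall>w. G x a w + christoffel x u u w = 0) \<longrightarrow>
    (\<forall>w. G y b w + christoffel y v v w = 0) \<longrightarrow> norm (a - b) \<le> K * (norm (x - y) + norm (u - v))"
proof (rule local_bounds[OF assms(1)])
  fix \<delta> \<mu> L B assume *: "\<delta> > 0" "\<mu> > 0" "L \<ge> 0" "B \<ge> 0" "cball x0 \<delta> \<subseteq> S"
    "\<And>x u. x\<in>cball x0 \<delta> \<Longrightarrow> \<mu> * (norm u)\<^sup>2 \<le> G x u u"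
    "\<And>x y u v. x\<in>cball x0 \<delta> \<Longrightarrow> y\<in>cball x0 \<delta> \<Longrightarrow> \<bar>G x u v - G y u v\<bar> \<le> L * dist x y * norm u * norm v"
    "\<And>x u v w. x\<in>cball x0 \<delta> \<Longrightarrow> \<bar>dG x u v w\<bar> \<le> B * norm u * norm v * norm w"
    "\<And>x y u v w. x\<in>cball x0 \<delta> \<Longrightarrow> y\<in>cball x0 \<delta> \<Longrightarrow>
        \<bar>dG x u v w - dG y u v w\<bar> \<le> L * dist x y * norm u * norm v * norm w"
  have christoffel_bound: "\<bar>christoffel x u v w\<bar> \<le> 2 * B * norm u * norm v * norm w" if "x \<in> cball x0 \<delta>" for x u v w
  proof -
    have "B * norm u * norm v * norm w \<ge> 0" using * by simp
    moreover have "\<bar>dG x u v w\<bar> \<le> B * norm u * norm v * norm w"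
      "\<bar>dG x v u w\<bar> \<le> B * norm u * norm v * norm w" "\<bar>dG x w u v\<bar> \<le> B * norm u * norm v * norm w"
      using *(8)[OF that, of u v w] *(8)[OF that, of v u w] *(8)[OF that, of w u v] by (simp_all add: mult_ac)
    ultimately show ?thesis unfolding christoffel_def by (simp add: abs_le_iff)
  qed
  have christoffel_lip: "\<bar>christoffel x u v w - christoffel y u v w\<bar> \<le> 2 * L * dist x y * norm u * norm v * norm w"
    if xy: "x \<in> cball x0 \<delta>" "y \<in> cball x0 \<delta>" for x y u v w
  proof -
    define T where "T = L * dist x y * norm u * norm v * norm w"
    have "T \<ge> 0" using * by (simp add: T_def)
    moreover have "\<bar>dG x u v w - dG y u v w\<bar> \<le> T" "\<bar>dG x v u w - dG y v u w\<bar> \<le> T"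
      "\<bar>dG x w u v - dG y w u v\<bar> \<le> T"
      using *(9)[OF xy, of u v w] *(9)[OF xy, of v u w] *(9)[OF xy, of w u v]
      by (simp_all add: T_def mult_ac)
    ultimately have "\<bar>christoffel x u v w - christoffel y u v w\<bar> \<le> 2 * T" unfolding christoffel_def by argo
    then show ?thesis by (simp add: T_def mult_ac)
  qed
  define A where "A = 2 * B * R * R / \<mu>"
  define K where "K = (2 * L * R * R + L * A + 4 * B * R) / \<mu>"
  have A: "A \<ge> 0" using * R by (simp add: A_def)
  have K: "K \<ge> 0" using * R A by (simp add: K_def)
  have "norm (a - b) \<le> K * (norm (x - y) + norm (u - v))"
    if xy: "x \<in> cball x0 \<delta>" "y \<in> cball x0 \<delta>" and uv: "norm u \<le> R" "norm v \<le> R"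
      and a: "\<And>w. G x a w + christoffel x u u w = 0" and b: "\<And>w. G y b w + christoffel y v v w = 0"
    for x y u v a b
  proof -
    have S: "x \<in> S" "y \<in> S" using xy *(5) by auto
    \<comment> \<open>The equation tested with \<open>b\<close> itself bounds \<open>b\<close> in terms of the velocity.\<close>
    have nb: "norm b \<le> A"
    proof (cases "b = 0")
      case False
      have "\<mu> * (norm b)\<^sup>2 \<le> \<bar>christoffel y v v b\<bar>" using *(6)[OF xy(2), of b] b[of b] by simp
      also have "\<dots> \<le> 2 * B * norm v * norm v * norm b" by (rule christoffel_bound[OF xy(2)])
      also have "\<dots> \<le> 2 * B * R * R * norm b" using uv * R by (intro mult_right_mono mult_mono) auto
      finally have "(\<mu> * norm b) * norm b \<le> (2 * B * R * R) * norm b" by (simp add: power2_eq_square mult_ac)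
      then have "\<mu> * norm b \<le> 2 * B * R * R" using False by simp
      then show ?thesis using * by (simp add: A_def field_simps)
    qed (use A in simp)
    define w where "w = a - b"
    define N where "N = norm (x - y) + norm (u - v)"
    have N: "N \<ge> 0" "dist x y \<le> N" "norm (u - v) \<le> N" by (auto simp: N_def dist_norm)
    have "G x w w = (G y b w - G x b w) + (christoffel y u u w - christoffel x u u w) + (christoffel y v v w - christoffel y u u w)"
      using a[of w] b[of w] linear_diff[OF linear_left[OF S(1)], of a b w]
      by (simp add: w_def[symmetric])
    also have "christoffel y v v w - christoffel y u u w = - christoffel y (u - v) u w - christoffel y (u - v) v w"
      using S(2) by (simp add: christoffel_diff christoffel_left_symmetric[of y v u])
    also have "(G y b w - G x b w) + (christoffel y u u w - christoffel x u u w) + (- christoffel y (u - v) u w - christoffel y (u - v) v w)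
      \<le> L * N * A * norm w + 2 * L * N * R * R * norm w
        + (2 * B * N * R * norm w + 2 * B * N * R * norm w)"
    proof (intro add_mono)
      have "G y b w - G x b w \<le> L * dist x y * norm b * norm w"
        using *(7)[OF xy, of b w] by (simp add: abs_le_iff)
      also have "\<dots> \<le> L * N * A * norm w" using N nb A *(3) by (intro mult_mono) auto
      finally show "G y b w - G x b w \<le> L * N * A * norm w" .
      have "christoffel y u u w - christoffel x u u w \<le> 2 * L * dist x y * norm u * norm u * norm w"
        using christoffel_lip[OF xy, of u u w] by (simp add: abs_le_iff)
      also have "\<dots> \<le> 2 * L * N * R * R * norm w" using N uv * R by (intro mult_mono) auto
      finally show "christoffel y u u w - christoffel x u u w \<le> 2 * L * N * R * R * norm w" .
      have c: "\<bar>christoffel y (u - v) z w\<bar> \<le> 2 * B * N * R * norm w" if "norm z \<le> R" for z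
      proof -
        have "\<bar>christoffel y (u - v) z w\<bar> \<le> 2 * B * norm (u - v) * norm z * norm w" by (rule christoffel_bound[OF xy(2)])
        also have "\<dots> \<le> 2 * B * N * R * norm w" using N that * R by (intro mult_mono) auto
        finally show ?thesis .
      qed
      show "- christoffel y (u - v) u w - christoffel y (u - v) v w \<le> 2 * B * N * R * norm w + 2 * B * N * R * norm w"
        using c[OF uv(1)] c[OF uv(2)] by (simp add: abs_le_iff)
    qed
    also have "\<dots> = (2 * L * R * R + L * A + 4 * B * R) * N * norm w" by (simp add: algebra_simps)
    also have "2 * L * R * R + L * A + 4 * B * R = \<mu> * K" using *(2) by (simp add: K_def)
    finally have "\<mu> * (norm w)\<^sup>2 \<le> \<mu> * K * N * norm w" using *(6)[OF xy(1), of w] by linarith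
    then have "\<mu> * norm w * norm w \<le> \<mu> * (K * N) * norm w" by (simp add: power2_eq_square mult_ac)
    then have "norm w \<le> K * N" using *(2) K N by (cases "w = 0") auto
    then show ?thesis by (simp add: w_def N_def)
  qed
  then show ?thesis using *(1) K by blast
qed

text \<open>
  Symmetry makes the derivative equal to \<open>2 * G c a c' + dG c c' c' c'\<close>, and the Christoffel symbol
  with three equal arguments \<open>c'\<close> is half of \<open>dG c c' c' c'\<close>, so that the geodesic equation tested
  with \<open>c'\<close> says that this vanishes.
\<close>

lemma energy_derivative:
  fixes c :: "real \<Rightarrow> 'e"
  assumes t: "c t \<in> S"
    and c: "(c has_vector_derivative c' t) (at t within I)"
    and a: "(c' has_vector_derivative a) (at t within I)"
    and I: "t \<in> I" "\<epsilon> > 0" "\<And>s. s \<in> I \<Longrightarrow> dist s t < \<epsilon> \<Longrightarrow> c s \<in> S"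
    and geo: "\<And>w. G (c t) a w + christoffel (c t) (c' t) (c' t) w = 0"
  shows "((\<lambda>s. G (c s) (c' s) (c' s)) has_vector_derivative 0) (at t within I)"
proof -
  have expand: "G x u v = (\<Sum>i\<in>Basis. \<Sum>j\<in>Basis. (u \<bullet> i) * (v \<bullet> j) * G x i j)" if "x \<in> S" for x u v
  proof -
    have "G x u v = G x (\<Sum>i\<in>Basis. (u \<bullet> i) *\<^sub>R i) (\<Sum>j\<in>Basis. (v \<bullet> j) *\<^sub>R j)"
      by (simp add: euclidean_representation)
    also have "\<dots> = (\<Sum>i\<in>Basis. (u \<bullet> i) * G x i (\<Sum>j\<in>Basis. (v \<bullet> j) *\<^sub>R j))"
      by (simp add: linear_sum[OF linear_left[OF that]] linear_scale[OF linear_left[OF that]])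
    also have "\<dots> = (\<Sum>i\<in>Basis. \<Sum>j\<in>Basis. (u \<bullet> i) * (v \<bullet> j) * G x i j)"
      by (simp add: linear_sum[OF linear_right[OF that]] linear_scale[OF linear_right[OF that]] sum_distrib_left mult_ac)
    finally show ?thesis .
  qed
  have expand': "dG x k u v = (\<Sum>i\<in>Basis. \<Sum>j\<in>Basis. (u \<bullet> i) * (v \<bullet> j) * dG x k i j)" if "x \<in> S" for x k u v
  proof -
    have "dG x k u v = dG x k (\<Sum>i\<in>Basis. (u \<bullet> i) *\<^sub>R i) (\<Sum>j\<in>Basis. (v \<bullet> j) *\<^sub>R j)"
      by (simp add: euclidean_representation)
    also have "\<dots> = (\<Sum>i\<in>Basis. (u \<bullet> i) * dG x k i (\<Sum>j\<in>Basis. (v \<bullet> j) *\<^sub>R j))"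
      by (simp add: linear_sum[OF linear_dG2[OF that]] linear_scale[OF linear_dG2[OF that]])
    also have "\<dots> = (\<Sum>i\<in>Basis. \<Sum>j\<in>Basis. (u \<bullet> i) * (v \<bullet> j) * dG x k i j)"
      by (simp add: linear_sum[OF linear_dG3[OF that]] linear_scale[OF linear_dG3[OF that]] sum_distrib_left mult_ac)
    finally show ?thesis .
  qed
  have dc': "((\<lambda>s. c' s \<bullet> i) has_vector_derivative (a \<bullet> i)) (at t within I)" for i
    using a by (auto simp: has_vector_derivative_def intro!: derivative_eq_intros)
  have dg: "((\<lambda>s. G (c s) i j) has_vector_derivative dG (c t) (c' t) i j) (at t within I)" for i j
    using vector_derivative_diff_chain_within[OF c has_derivative_at_withinI[OF has_derivative_G[OF t]]]
    by (simp add: o_def)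
  have "((\<lambda>s. \<Sum>i\<in>Basis. \<Sum>j\<in>Basis. (c' s \<bullet> i) * (c' s \<bullet> j) * G (c s) i j) has_vector_derivative
     (\<Sum>i\<in>Basis. \<Sum>j\<in>Basis. (c' t \<bullet> i) * (c' t \<bullet> j) * dG (c t) (c' t) i j
        + ((c' t \<bullet> i) * (a \<bullet> j) + (a \<bullet> i) * (c' t \<bullet> j)) * G (c t) i j)) (at t within I)"
    by (intro has_vector_derivative_sum has_vector_derivative_mult dc' dg)
  also have "(\<Sum>i\<in>Basis. \<Sum>j\<in>Basis. (c' t \<bullet> i) * (c' t \<bullet> j) * dG (c t) (c' t) i j
        + ((c' t \<bullet> i) * (a \<bullet> j) + (a \<bullet> i) * (c' t \<bullet> j)) * G (c t) i j)
    = dG (c t) (c' t) (c' t) (c' t) + (G (c t) (c' t) a + G (c t) a (c' t))"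
    by (simp only: expand[OF t, of "c' t" a] expand[OF t, of a "c' t"]
        expand'[OF t, of "c' t" "c' t" "c' t"] sum.distrib[symmetric] distrib_right)
  also have "\<dots> = 0"
    using geo[of "c' t"] symmetric[OF t, of a "c' t"] by (simp add: christoffel_def)
  finally show ?thesis
    by (rule has_vector_derivative_transform_within[OF _ I(2,1)]) (intro expand[symmetric] I(3))
qed

end

section \<open>Uniqueness and reversal in one real variable\<close>

text \<open>
  Forwards from \<open>t0\<close> the function \<open>exp (- K * t) * \<phi> t\<close> is nonincreasing; backwards,
  \<open>exp (K * t) * \<phi> t\<close> is nondecreasing.
\<close>

lemma gronwall_zero:
  fixes \<phi> :: "real \<Rightarrow> real"
  assumes der: "\<And>t. t \<in> {a..b} \<Longrightarrow> (\<phi> has_vector_derivative \<phi>' t) (at t within {a..b})"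
    and bound: "\<And>t. t \<in> {a..b} \<Longrightarrow> \<bar>\<phi>' t\<bar> \<le> K * \<phi> t"
    and t0: "t0 \<in> {a..b}" "\<phi> t0 = 0" and t: "t \<in> {a..b}"
  shows "\<phi> t \<le> 0"
proof -
  have D: "((\<lambda>s. exp (k * s) * \<phi> s) has_derivative (\<lambda>h. h * (exp (k * s) * (\<phi>' s + k * \<phi> s))))
      (at s within {c..d})" if "s \<in> {c..d}" "{c..d} \<subseteq> {a..b}" for k s c d
  proof -
    have "(\<phi> has_real_derivative \<phi>' s) (at s within {c..d})"
      using that has_vector_derivative_within_subset[OF der, of s "{c..d}"]
      by (auto simp: has_real_derivative_iff_has_vector_derivative)
    then have "((\<lambda>s. exp (k * s) * \<phi> s) has_real_derivative exp (k * s) * (\<phi>' s + k * \<phi> s)) (at s within {c..d})"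
      by (auto intro!: derivative_eq_intros simp: algebra_simps)
    then show ?thesis by (simp add: has_field_derivative_def mult_commute_abs mult.commute)
  qed
  consider "t0 \<le> t" | "t \<le> t0" by linarith
  then show ?thesis
  proof cases
    case 1
    have sub: "{t0..t} \<subseteq> {a..b}" using t0 t by auto
    obtain s where s: "s \<in> {t0..t}"
      "exp (- K * t) * \<phi> t - exp (- K * t0) * \<phi> t0 = (t - t0) * (exp (- K * s) * (\<phi>' s + - K * \<phi> s))"
      using mvt_very_simple[OF 1 D[OF _ sub, of _ "- K"]] by auto
    have "\<phi>' s + - K * \<phi> s \<le> 0" using bound[of s] s(1) sub by (auto simp: abs_le_iff)
    then have "(t - t0) * (exp (- K * s) * (\<phi>' s + - K * \<phi> s)) \<le> 0"
      using 1 by (intro mult_nonneg_nonpos) auto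
    then have "exp (- K * t) * \<phi> t \<le> 0" using s(2) t0(2) by simp
    then show ?thesis by (simp add: mult_le_0_iff)
  next
    case 2
    have sub: "{t..t0} \<subseteq> {a..b}" using t0 t by auto
    obtain s where s: "s \<in> {t..t0}"
      "exp (K * t0) * \<phi> t0 - exp (K * t) * \<phi> t = (t0 - t) * (exp (K * s) * (\<phi>' s + K * \<phi> s))"
      using mvt_very_simple[OF 2 D[OF _ sub, of _ K]] by auto
    have "\<phi>' s + K * \<phi> s \<ge> 0" using bound[of s] s(1) sub by (auto simp: abs_le_iff)
    then have "(t0 - t) * (exp (K * s) * (\<phi>' s + K * \<phi> s)) \<ge> 0"
      using 2 by (intro mult_nonneg_nonneg) auto
    then have "exp (K * t) * \<phi> t \<le> 0" using s(2) t0(2) by simp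
    then show ?thesis by (simp add: mult_le_0_iff)
  qed
qed

lemma has_vector_derivative_reverse:
  fixes f :: "real \<Rightarrow> 'b::real_normed_vector"
  assumes "(f has_vector_derivative f') (at (1 - t) within {0..1})"
  shows "((\<lambda>s. f (1 - s)) has_vector_derivative - f') (at t within {0..1})"
proof -
  have "((\<lambda>s. 1 - s) has_vector_derivative - 1) (at t within {0..1::real})"
    by (auto intro!: derivative_eq_intros)
  moreover have "(\<lambda>s. 1 - s) ` {0..1::real} = {0..1}" by simp
  ultimately show ?thesis using vector_diff_chain_within[of "\<lambda>s. 1 - s" "-1" t "{0..1}" f f'] assms
    by (simp add: o_def)
qed

section \<open>Charts and tangent spaces\<close>

locale riemannian_manifold =
  fixes M :: "('m::{t2_space,second_countable_topology}, 'e::euclidean_space) riem_structure"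
  assumes manifold: "connected_riemannian_manifold M"
begin

lemma chart_homeomorphism:
  assumes "\<kappa> \<in> atlas M"
  shows "open (fst \<kappa>)" "open (snd \<kappa> ` fst \<kappa>)"
    "homeomorphism (fst \<kappa>) (snd \<kappa> ` fst \<kappa>) (snd \<kappa>) (chart_inv \<kappa>)"
  using manifold assms by (auto simp: connected_riemannian_manifold_def smooth_atlas_def is_chart_def)

lemma charts_atD:
  assumes "\<kappa> \<in> charts_at M p"
  shows "\<kappa> \<in> atlas M" "p \<in> fst \<kappa>" "snd \<kappa> p \<in> snd \<kappa> ` fst \<kappa>"
  using assms by (auto simp: charts_at_def)

lemma ex_chart: "\<exists>\<kappa>. \<kappa> \<in> charts_at M p"
  using manifold unfolding connected_riemannian_manifold_def smooth_atlas_def charts_at_def by blast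

lemma chart_inv_left: "\<kappa> \<in> charts_at M p \<Longrightarrow> chart_inv \<kappa> (snd \<kappa> p) = p"
  by (rule homeomorphism_apply1[OF chart_homeomorphism(3)]) (use charts_atD in blast)+

lemma overlap_open:
  assumes "\<kappa> \<in> atlas M" "\<kappa>' \<in> atlas M" shows "open (snd \<kappa> ` (fst \<kappa> \<inter> fst \<kappa>'))"
proof -
  have "openin (top_of_set (fst \<kappa>)) (fst \<kappa> \<inter> fst \<kappa>')"
    using chart_homeomorphism(1)[OF assms(2)] by (simp add: openin_open_Int)
  then have "openin (top_of_set (snd \<kappa> ` fst \<kappa>)) (snd \<kappa> ` (fst \<kappa> \<inter> fst \<kappa>'))"
    by (rule homeomorphism_imp_open_map[OF chart_homeomorphism(3)[OF assms(1)]])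
  then show ?thesis using chart_homeomorphism(2)[OF assms(1)] by (simp add: openin_open_eq)
qed

abbreviation dtrans :: "'m \<Rightarrow> ('m, 'e) chart \<Rightarrow> ('m, 'e) chart \<Rightarrow> 'e \<Rightarrow> 'e" where
  "dtrans p \<kappa> \<kappa>' \<equiv> frechet_derivative (transition \<kappa> \<kappa>') (at (snd \<kappa> p))"

lemma has_derivative_transition:
  assumes "\<kappa> \<in> charts_at M p" "\<kappa>' \<in> charts_at M p"
  shows "(transition \<kappa> \<kappa>' has_derivative dtrans p \<kappa> \<kappa>') (at (snd \<kappa> p))"
proof -
  have "smooth_on (snd \<kappa> ` (fst \<kappa> \<inter> fst \<kappa>')) (transition \<kappa> \<kappa>')"
    using manifold charts_atD assms by (auto simp: connected_riemannian_manifold_def smooth_atlas_def)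
  then have "Ck_on (Suc 0) (snd \<kappa> ` (fst \<kappa> \<inter> fst \<kappa>')) (transition \<kappa> \<kappa>')"
    by (simp only: smooth_on_def)
  moreover have "snd \<kappa> p \<in> snd \<kappa> ` (fst \<kappa> \<inter> fst \<kappa>')" using assms charts_atD by blast
  ultimately have "transition \<kappa> \<kappa>' differentiable at (snd \<kappa> p)" unfolding Ck_on.simps by blast
  then show ?thesis by (simp add: frechet_derivative_works)
qed

text \<open>
  The chain rule for chart transitions. It makes the coordinate representations of a tangent vector in
  different charts compatible.
\<close>

lemma dtrans_compose:
  assumes "\<kappa> \<in> charts_at M p" "\<kappa>' \<in> charts_at M p" "\<kappa>'' \<in> charts_at M p"
  shows "dtrans p \<kappa>' \<kappa>'' (dtrans p \<kappa> \<kappa>' u) = dtrans p \<kappa> \<kappa>'' u"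
proof -
  have "(transition \<kappa>' \<kappa>'' has_derivative dtrans p \<kappa>' \<kappa>'') (at (transition \<kappa> \<kappa>' (snd \<kappa> p)))"
    using has_derivative_transition[OF assms(2,3)] chart_inv_left[OF assms(1)] by simp
  from diff_chain_at[OF has_derivative_transition[OF assms(1,2)] this]
  have "(transition \<kappa>' \<kappa>'' \<circ> transition \<kappa> \<kappa>' has_derivative dtrans p \<kappa>' \<kappa>'' \<circ> dtrans p \<kappa> \<kappa>') (at (snd \<kappa> p))" .
  then have "(transition \<kappa> \<kappa>'' has_derivative dtrans p \<kappa>' \<kappa>'' \<circ> dtrans p \<kappa> \<kappa>') (at (snd \<kappa> p))"
  proof (rule has_derivative_transform_within_open)
    show "open (snd \<kappa> ` (fst \<kappa> \<inter> fst \<kappa>'))" using assms charts_atD overlap_open by blast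
    show "snd \<kappa> p \<in> snd \<kappa> ` (fst \<kappa> \<inter> fst \<kappa>')" using assms charts_atD by blast
    fix x assume "x \<in> snd \<kappa> ` (fst \<kappa> \<inter> fst \<kappa>')"
    then obtain q where q: "x = snd \<kappa> q" "q \<in> fst \<kappa>" "q \<in> fst \<kappa>'" by blast
    then have "\<kappa> \<in> charts_at M q" "\<kappa>' \<in> charts_at M q" using assms by (auto simp: charts_at_def)
    then show "(transition \<kappa>' \<kappa>'' \<circ> transition \<kappa> \<kappa>') x = transition \<kappa> \<kappa>'' x"
      using q by (simp add: chart_inv_left)
  qed
  from has_derivative_unique[OF this has_derivative_transition[OF assms(1,3)]]
  show ?thesis by (simp add: fun_eq_iff)
qed

lemma dtrans_same:
  assumes "\<kappa> \<in> charts_at M p" shows "dtrans p \<kappa> \<kappa> u = u"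
proof -
  have "(transition \<kappa> \<kappa> has_derivative (\<lambda>x. x)) (at (snd \<kappa> p))"
  proof (rule has_derivative_transform_within_open[OF has_derivative_ident])
    show "open (snd \<kappa> ` fst \<kappa>)" "snd \<kappa> p \<in> snd \<kappa> ` fst \<kappa>"
      using assms charts_atD chart_homeomorphism by auto
    fix x assume "x \<in> snd \<kappa> ` fst \<kappa>"
    then show "x = transition \<kappa> \<kappa> x" by (simp add: f_inv_into_f)
  qed
  from fun_cong[OF has_derivative_unique[OF this has_derivative_transition[OF assms assms]], of u]
  show ?thesis by (rule sym)
qed

lemma tvec_of_coord_in_tangent_space:
  "\<kappa> \<in> charts_at M p \<Longrightarrow> tvec_of_coord M p \<kappa> u \<in> tangent_space M p"
  by (simp add: tangent_space_def tvec_of_coord_def dtrans_compose)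

lemma tvec_of_coord_same: "\<kappa> \<in> charts_at M p \<Longrightarrow> tvec_of_coord M p \<kappa> u \<kappa> = u"
  by (simp add: tvec_of_coord_def dtrans_same)

lemma tvec_of_coord_inverse:
  assumes "\<kappa> \<in> charts_at M p" "X \<in> tangent_space M p"
  shows "tvec_of_coord M p \<kappa> (X \<kappa>) = X"
proof
  fix \<kappa>'
  have "X \<kappa>' = dtrans p \<kappa> \<kappa>' (X \<kappa>)" if "\<kappa>' \<in> charts_at M p"
    using assms that unfolding tangent_space_def by blast
  moreover have "X \<kappa>' = 0" if "\<kappa>' \<notin> charts_at M p"
    using assms that unfolding tangent_space_def by blast
  ultimately show "tvec_of_coord M p \<kappa> (X \<kappa>) \<kappa>' = X \<kappa>'"
    unfolding tvec_of_coord_def by (simp split: if_split)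
qed

lemma tvec_of_coord_lincomb:
  assumes "\<kappa> \<in> charts_at M p"
  shows "tvec_of_coord M p \<kappa> (a *\<^sub>R u + b *\<^sub>R v) =
    lincomb a (tvec_of_coord M p \<kappa> u) b (tvec_of_coord M p \<kappa> v)"
proof
  fix \<kappa>'
  have "linear (dtrans p \<kappa> \<kappa>')" if "\<kappa>' \<in> charts_at M p"
    using has_derivative_linear[OF has_derivative_transition[OF assms that]] .
  then show "tvec_of_coord M p \<kappa> (a *\<^sub>R u + b *\<^sub>R v) \<kappa>' =
      lincomb a (tvec_of_coord M p \<kappa> u) b (tvec_of_coord M p \<kappa> v) \<kappa>'"
    by (simp add: tvec_of_coord_def lincomb_def linear_add linear_scale)
qed

lemma metric_in_chart:
  "\<kappa> \<in> charts_at M p \<Longrightarrow> metric_in M \<kappa> (snd \<kappa> p) u v =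
    metric M p (tvec_of_coord M p \<kappa> u) (tvec_of_coord M p \<kappa> v)"
  by (simp add: metric_in_def chart_inv_left)

lemma coordinate_metric_chart:
  assumes "\<kappa> \<in> atlas M" shows "coordinate_metric (snd \<kappa> ` fst \<kappa>) (metric_in M \<kappa>)"
proof (rule coordinate_metric.intro)
  show "open (snd \<kappa> ` fst \<kappa>)" using chart_homeomorphism assms by blast
  show "smooth_on (snd \<kappa> ` fst \<kappa>) (\<lambda>x. metric_in M \<kappa> x u v)" for u v
    using manifold assms by (simp add: connected_riemannian_manifold_def)
  fix x assume "x \<in> snd \<kappa> ` fst \<kappa>"
  then obtain p where p: "x = snd \<kappa> p" "\<kappa> \<in> charts_at M p" using assms by (auto simp: charts_at_def)
  note T = tvec_of_coord_in_tangent_space[OF p(2)]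
  have ip: "inner_product_on_tangent M p" using manifold by (simp add: connected_riemannian_manifold_def)
  have bil: "metric_in M \<kappa> x (a *\<^sub>R u + b *\<^sub>R v) w = a * metric_in M \<kappa> x u w + b * metric_in M \<kappa> x v w"
    for a b u v w
    using ip T by (simp add: inner_product_on_tangent_def p metric_in_chart tvec_of_coord_lincomb)
  show "linear (\<lambda>u. metric_in M \<kappa> x u v)" for v
    using bil[of 1 _ 1] bil[of _ _ 0 0] by (intro linearI) auto
  show "metric_in M \<kappa> x u v = metric_in M \<kappa> x v u" for u v
    using ip T by (simp add: inner_product_on_tangent_def p metric_in_chart)
  show "metric_in M \<kappa> x u u > 0" if "u \<noteq> 0" for u
  proof -
    have "tvec_of_coord M p \<kappa> u \<noteq> (\<lambda>_. 0)"
    proof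
      assume "tvec_of_coord M p \<kappa> u = (\<lambda>_. 0)"
      then have "tvec_of_coord M p \<kappa> u \<kappa> = 0" by simp
      then show False using that tvec_of_coord_same[OF p(2), of u] by simp
    qed
    then show ?thesis using ip T by (simp add: inner_product_on_tangent_def p metric_in_chart)
  qed
qed

lemma christoffel1_eq_christoffel:
  assumes "\<kappa> \<in> atlas M"
  shows "christoffel1 M \<kappa> = coordinate_metric.christoffel (metric_in M \<kappa>)"
proof -
  interpret coordinate_metric "snd \<kappa> ` fst \<kappa>" "metric_in M \<kappa>"
    by (rule coordinate_metric_chart[OF assms])
  show ?thesis by (intro ext) (simp add: christoffel1_def christoffel_def dG_def)
qed

lemma metric_neg:
  assumes "X \<in> tangent_space M p" shows "metric M p (\<lambda>\<kappa>. - X \<kappa>) (\<lambda>\<kappa>. - X \<kappa>) = metric M p X X"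
proof -
  have ip: "inner_product_on_tangent M p" using manifold by (simp add: connected_riemannian_manifold_def)
  have lin: "metric M p (lincomb a Y b Z) W = a * metric M p Y W + b * metric M p Z W"
    if "Y \<in> tangent_space M p" "Z \<in> tangent_space M p" "W \<in> tangent_space M p" for a b Y Z W
    using ip that unfolding inner_product_on_tangent_def by blast
  obtain \<kappa> where \<kappa>: "\<kappa> \<in> charts_at M p" using ex_chart by blast
  have neg: "(\<lambda>\<kappa>. - X \<kappa>) = lincomb (-1) X 0 X" by (simp add: lincomb_def fun_eq_iff)
  have "lincomb (-1) X 0 X = tvec_of_coord M p \<kappa> ((-1) *\<^sub>R X \<kappa> + 0 *\<^sub>R X \<kappa>)"
    by (subst tvec_of_coord_lincomb[OF \<kappa>]) (simp add: tvec_of_coord_inverse[OF \<kappa> assms])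
  then have T: "lincomb (-1) X 0 X \<in> tangent_space M p"
    using tvec_of_coord_in_tangent_space[OF \<kappa>] by simp
  have "metric M p (lincomb (-1) X 0 X) (lincomb (-1) X 0 X) = - metric M p X (lincomb (-1) X 0 X)"
    using lin[OF assms assms T] by simp
  also have "metric M p X (lincomb (-1) X 0 X) = metric M p (lincomb (-1) X 0 X) X"
    using ip assms T unfolding inner_product_on_tangent_def by blast
  also have "\<dots> = - metric M p X X" using lin[OF assms assms assms] by simp
  finally show ?thesis by (simp add: neg)
qed

section \<open>Geodesics\<close>

lemma nearby_in_chart:
  assumes "continuous_on {0..1::real} \<gamma>" "t \<in> {0..1}" "\<kappa> \<in> charts_at M (\<gamma> t)"
  obtains \<epsilon> where "\<epsilon> > 0" "\<And>s. s \<in> {0..1} \<Longrightarrow> dist s t < \<epsilon> \<Longrightarrow> \<kappa> \<in> charts_at M (\<gamma> s)"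
proof -
  have "openin (top_of_set {0..1}) ({0..1} \<inter> \<gamma> -` fst \<kappa>)"
    using continuous_openin_preimage_gen[OF assms(1)] chart_homeomorphism(1) charts_atD(1)[OF assms(3)] by blast
  moreover have "t \<in> {0..1} \<inter> \<gamma> -` fst \<kappa>" using assms charts_atD by auto
  ultimately obtain \<epsilon> where "\<epsilon> > 0" "\<And>s. s \<in> {0..1} \<Longrightarrow> dist s t < \<epsilon> \<Longrightarrow> \<gamma> s \<in> fst \<kappa>"
    unfolding openin_euclidean_subtopology_iff by blast
  then show thesis using that charts_atD(1)[OF assms(3)] by (auto simp: charts_at_def)
qed

abbreviation coord :: "('m, 'e) chart \<Rightarrow> (real \<Rightarrow> 'm) \<Rightarrow> real \<Rightarrow> 'e" where
  "coord \<kappa> \<gamma> \<equiv> snd \<kappa> \<circ> \<gamma>"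

abbreviation coord' :: "('m, 'e) chart \<Rightarrow> (real \<Rightarrow> 'm) \<Rightarrow> real \<Rightarrow> 'e" where
  "coord' \<kappa> \<gamma> t \<equiv> vector_derivative (snd \<kappa> \<circ> \<gamma>) (at t within {0..1})"

text \<open>
  One chart determines the velocity: near \<open>t\<close> the curve in another chart is its image under the
  transition.
\<close>

lemma velocity_eq_tvec_of_coord:
  assumes "continuous_on {0..1} \<gamma>" "t \<in> {0..1}" "\<kappa> \<in> charts_at M (\<gamma> t)"
    and "coord \<kappa> \<gamma> differentiable (at t within {0..1})"
  shows "velocity M \<gamma> t = tvec_of_coord M (\<gamma> t) \<kappa> (coord' \<kappa> \<gamma> t)"
proof
  fix \<kappa>'
  show "velocity M \<gamma> t \<kappa>' = tvec_of_coord M (\<gamma> t) \<kappa> (coord' \<kappa> \<gamma> t) \<kappa>'"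
  proof (cases "\<kappa>' \<in> charts_at M (\<gamma> t)")
    case True
    have "(transition \<kappa> \<kappa>' has_derivative dtrans (\<gamma> t) \<kappa> \<kappa>')
        (at (coord \<kappa> \<gamma> t) within coord \<kappa> \<gamma> ` {0..1})"
      using has_derivative_at_withinI[OF has_derivative_transition[OF assms(3) True]] by simp
    then have "(transition \<kappa> \<kappa>' \<circ> coord \<kappa> \<gamma> has_vector_derivative dtrans (\<gamma> t) \<kappa> \<kappa>' (coord' \<kappa> \<gamma> t))
        (at t within {0..1})"
      using vector_derivative_diff_chain_within assms(4) vector_derivative_works by blast
    moreover obtain \<epsilon> where \<epsilon>: "\<epsilon> > 0" "\<And>s. s \<in> {0..1} \<Longrightarrow> dist s t < \<epsilon> \<Longrightarrow> \<kappa> \<in> charts_at M (\<gamma> s)"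
      using nearby_in_chart[OF assms(1-3)] by blast
    ultimately have "(coord \<kappa>' \<gamma> has_vector_derivative dtrans (\<gamma> t) \<kappa> \<kappa>' (coord' \<kappa> \<gamma> t)) (at t within {0..1})"
      using assms(2) by (elim has_vector_derivative_transform_within) (auto simp: chart_inv_left)
    from vector_derivative_within_closed_interval[OF _ assms(2) this]
    show ?thesis using True by (simp add: velocity_def tvec_of_coord_def)
  qed (simp add: velocity_def tvec_of_coord_def)
qed

lemma geodesic_coord:
  assumes "geodesic M \<gamma>" "t \<in> {0..1}" "\<kappa> \<in> charts_at M (\<gamma> t)"
  shows "(coord \<kappa> \<gamma> has_vector_derivative coord' \<kappa> \<gamma> t) (at t within {0..1})"
    and "\<exists>a. (coord' \<kappa> \<gamma> has_vector_derivative a) (at t within {0..1}) \<and>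
      (\<forall>w. metric_in M \<kappa> (coord \<kappa> \<gamma> t) a w +
        coordinate_metric.christoffel (metric_in M \<kappa>) (coord \<kappa> \<gamma> t) (coord' \<kappa> \<gamma> t) (coord' \<kappa> \<gamma> t) w = 0)"
proof -
  have "coord \<kappa> \<gamma> differentiable (at t within {0..1}) \<and>
    (\<exists>a. (coord' \<kappa> \<gamma> has_vector_derivative a) (at t within {0..1}) \<and>
      (\<forall>w. metric_in M \<kappa> (coord \<kappa> \<gamma> t) a w +
        christoffel1 M \<kappa> (coord \<kappa> \<gamma> t) (coord' \<kappa> \<gamma> t) (coord' \<kappa> \<gamma> t) w = 0))"
    using assms unfolding geodesic_def Let_def by blast
  then show "(coord \<kappa> \<gamma> has_vector_derivative coord' \<kappa> \<gamma> t) (at t within {0..1})"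
    "\<exists>a. (coord' \<kappa> \<gamma> has_vector_derivative a) (at t within {0..1}) \<and>
      (\<forall>w. metric_in M \<kappa> (coord \<kappa> \<gamma> t) a w +
        coordinate_metric.christoffel (metric_in M \<kappa>) (coord \<kappa> \<gamma> t) (coord' \<kappa> \<gamma> t) (coord' \<kappa> \<gamma> t) w = 0)"
    unfolding christoffel1_eq_christoffel[OF charts_atD(1)[OF assms(3)]] vector_derivative_works by blast+
qed

lemma geodesic_coord_acceleration:
  assumes "geodesic M \<gamma>" "t \<in> {0..1}" "\<kappa> \<in> charts_at M (\<gamma> t)"
  obtains a where "(coord' \<kappa> \<gamma> has_vector_derivative a) (at t within {0..1})"
    "\<forall>w. metric_in M \<kappa> (coord \<kappa> \<gamma> t) a w +
        coordinate_metric.christoffel (metric_in M \<kappa>) (coord \<kappa> \<gamma> t) (coord' \<kappa> \<gamma> t) (coord' \<kappa> \<gamma> t) w = 0"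
  using geodesic_coord(2)[OF assms] by blast

lemma geodesic_velocity:
  assumes "geodesic M \<gamma>" "t \<in> {0..1}" "\<kappa> \<in> charts_at M (\<gamma> t)"
  shows "velocity M \<gamma> t = tvec_of_coord M (\<gamma> t) \<kappa> (coord' \<kappa> \<gamma> t)"
proof (rule velocity_eq_tvec_of_coord)
  show "coord \<kappa> \<gamma> differentiable (at t within {0..1})"
    using geodesic_coord(1)[OF assms] vector_derivative_works by blast
qed (use assms in \<open>auto simp: geodesic_def\<close>)

lemma geodesic_velocity_in_tangent_space:
  assumes "geodesic M \<gamma>" "t \<in> {0..1}" shows "velocity M \<gamma> t \<in> tangent_space M (\<gamma> t)"
proof -
  obtain \<kappa> where \<kappa>: "\<kappa> \<in> charts_at M (\<gamma> t)" using ex_chart by blast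
  show ?thesis unfolding geodesic_velocity[OF assms \<kappa>] by (rule tvec_of_coord_in_tangent_space[OF \<kappa>])
qed

text \<open>
  Near each instant the squared speed is the energy in a chart, so its derivative vanishes on the
  whole unit interval.
\<close>

lemma geodesic_constant_speed:
  assumes "geodesic M \<gamma>" "t \<in> {0..1}"
  shows "tnorm M (\<gamma> t) (velocity M \<gamma> t) = tnorm M (\<gamma> 0) (velocity M \<gamma> 0)"
proof -
  define E where "E s = metric M (\<gamma> s) (velocity M \<gamma> s) (velocity M \<gamma> s)" for s
  have "(E has_vector_derivative 0) (at t within {0..1})" if t: "t \<in> {0..1}" for t
  proof -
    obtain \<kappa> where \<kappa>: "\<kappa> \<in> charts_at M (\<gamma> t)" using ex_chart by blast
    have "continuous_on {0..1} \<gamma>" using assms by (simp add: geodesic_def)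
    from nearby_in_chart[OF this t \<kappa>] obtain \<epsilon>
      where \<epsilon>: "\<epsilon> > 0" "\<And>s. s \<in> {0..1} \<Longrightarrow> dist s t < \<epsilon> \<Longrightarrow> \<kappa> \<in> charts_at M (\<gamma> s)" by blast
    interpret coordinate_metric "snd \<kappa> ` fst \<kappa>" "metric_in M \<kappa>"
      by (rule coordinate_metric_chart[OF charts_atD(1)[OF \<kappa>]])
    obtain a where a: "(coord' \<kappa> \<gamma> has_vector_derivative a) (at t within {0..1})"
      "\<And>w. metric_in M \<kappa> (coord \<kappa> \<gamma> t) a w + christoffel (coord \<kappa> \<gamma> t) (coord' \<kappa> \<gamma> t) (coord' \<kappa> \<gamma> t) w = 0"
      using geodesic_coord(2)[OF assms(1) t \<kappa>] by blast
    have "((\<lambda>s. metric_in M \<kappa> (coord \<kappa> \<gamma> s) (coord' \<kappa> \<gamma> s) (coord' \<kappa> \<gamma> s)) has_vector_derivative 0)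
        (at t within {0..1})"
    proof (rule energy_derivative[where c = "coord \<kappa> \<gamma>" and c' = "coord' \<kappa> \<gamma>",
          OF _ geodesic_coord(1)[OF assms(1) t \<kappa>] a(1) t \<epsilon>(1) _ a(2)])
      show "coord \<kappa> \<gamma> t \<in> snd \<kappa> ` fst \<kappa>" using charts_atD(3)[OF \<kappa>] by simp
      show "coord \<kappa> \<gamma> s \<in> snd \<kappa> ` fst \<kappa>" if "s \<in> {0..1}" "dist s t < \<epsilon>" for s
        using charts_atD(3)[OF \<epsilon>(2)[OF that]] by simp
    qed
    then show ?thesis
    proof (rule has_vector_derivative_transform_within[OF _ \<epsilon>(1) t])
      fix s :: real assume s: "s \<in> {0..1}" "dist s t < \<epsilon>"
      show "metric_in M \<kappa> (coord \<kappa> \<gamma> s) (coord' \<kappa> \<gamma> s) (coord' \<kappa> \<gamma> s) = E s"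
        unfolding E_def geodesic_velocity[OF assms(1) s(1) \<epsilon>(2)[OF s]] by (simp add: metric_in_chart[OF \<epsilon>(2)[OF s]])
    qed
  qed
  then have "\<exists>c. \<forall>s\<in>{0..1}. E s = c"
    by (intro has_derivative_zero_constant) (auto simp: has_vector_derivative_def)
  then have "E t = E 0" using assms(2) by auto
  then show ?thesis by (simp add: tnorm_def E_def)
qed

lemma geodesic_length:
  assumes "geodesic M \<gamma>" shows "curve_length M \<gamma> = tnorm M (\<gamma> 0) (velocity M \<gamma> 0)"
proof -
  have "curve_length M \<gamma> = integral {0..1} (\<lambda>t::real. tnorm M (\<gamma> 0) (velocity M \<gamma> 0))"
    unfolding curve_length_def by (intro integral_cong geodesic_constant_speed[OF assms])
  then show ?thesis by simp
qed

lemma coord'_reverse: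
  assumes "geodesic M \<gamma>" "t \<in> {0..1}" "\<kappa> \<in> charts_at M (\<gamma> (1 - t))"
  shows "coord' \<kappa> (\<lambda>s. \<gamma> (1 - s)) t = - coord' \<kappa> \<gamma> (1 - t)"
  using has_vector_derivative_reverse[OF geodesic_coord(1)[OF assms(1) _ assms(3)]] assms(2)
  by (intro vector_derivative_within_closed_interval) (auto simp: o_def)

text \<open>
  Reversal changes the sign of the first derivative and keeps the second, and the Christoffel symbols
  are quadratic in the first derivative.
\<close>

lemma geodesic_reverse:
  assumes "geodesic M \<gamma>" shows "geodesic M (\<lambda>t. \<gamma> (1 - t))"
  unfolding geodesic_def Let_def
proof (intro conjI ballI)
  have cont: "continuous_on {0..1} \<gamma>" using assms by (simp add: geodesic_def)
  show contr: "continuous_on {0..1} (\<lambda>t. \<gamma> (1 - t))"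
    by (rule continuous_on_compose2[OF cont]) (auto intro!: continuous_intros)
  fix t :: real and \<kappa> assume t: "t \<in> {0..1}" and \<kappa>: "\<kappa> \<in> charts_at M (\<gamma> (1 - t))"
  have t': "1 - t \<in> {0..1}" using t by auto
  interpret coordinate_metric "snd \<kappa> ` fst \<kappa>" "metric_in M \<kappa>"
    by (rule coordinate_metric_chart[OF charts_atD(1)[OF \<kappa>]])
  show "coord \<kappa> (\<lambda>t. \<gamma> (1 - t)) differentiable at t within {0..1}"
    using has_vector_derivative_reverse[OF geodesic_coord(1)[OF assms t' \<kappa>]]
    by (auto simp: o_def has_vector_derivative_def differentiable_def)
  obtain a where a: "(coord' \<kappa> \<gamma> has_vector_derivative a) (at (1 - t) within {0..1})"
    "\<And>w. metric_in M \<kappa> (coord \<kappa> \<gamma> (1 - t)) a w +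
      christoffel (coord \<kappa> \<gamma> (1 - t)) (coord' \<kappa> \<gamma> (1 - t)) (coord' \<kappa> \<gamma> (1 - t)) w = 0"
    using geodesic_coord(2)[OF assms t' \<kappa>] by blast
  obtain \<epsilon> where \<epsilon>: "\<epsilon> > 0" "\<And>s. s \<in> {0..1} \<Longrightarrow> dist s t < \<epsilon> \<Longrightarrow> \<kappa> \<in> charts_at M (\<gamma> (1 - s))"
    using nearby_in_chart[OF contr t \<kappa>] by blast
  have "((\<lambda>s. - coord' \<kappa> \<gamma> (1 - s)) has_vector_derivative a) (at t within {0..1})"
    using has_vector_derivative_minus[OF has_vector_derivative_reverse[OF a(1)]] by simp
  then have "(coord' \<kappa> (\<lambda>t. \<gamma> (1 - t)) has_vector_derivative a) (at t within {0..1})"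
  proof (rule has_vector_derivative_transform_within[OF _ \<epsilon>(1) t])
    fix s :: real assume "s \<in> {0..1}" "dist s t < \<epsilon>"
    then show "- coord' \<kappa> \<gamma> (1 - s) = coord' \<kappa> (\<lambda>t. \<gamma> (1 - t)) s"
      by (intro coord'_reverse[OF assms, symmetric] \<epsilon>(2))
  qed
  moreover have "metric_in M \<kappa> (coord \<kappa> (\<lambda>t. \<gamma> (1 - t)) t) a w +
      christoffel1 M \<kappa> (coord \<kappa> (\<lambda>t. \<gamma> (1 - t)) t) (coord' \<kappa> (\<lambda>t. \<gamma> (1 - t)) t) (coord' \<kappa> (\<lambda>t. \<gamma> (1 - t)) t) w = 0" for w
    using a(2)[of w] charts_atD[OF \<kappa>]
    by (simp add: coord'_reverse[OF assms t \<kappa>] christoffel1_eq_christoffel christoffel_minus)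
  ultimately show "\<exists>a. (coord' \<kappa> (\<lambda>t. \<gamma> (1 - t)) has_vector_derivative a) (at t within {0..1}) \<and>
      (\<forall>w. metric_in M \<kappa> (coord \<kappa> (\<lambda>t. \<gamma> (1 - t)) t) a w +
      christoffel1 M \<kappa> (coord \<kappa> (\<lambda>t. \<gamma> (1 - t)) t) (coord' \<kappa> (\<lambda>t. \<gamma> (1 - t)) t) (coord' \<kappa> (\<lambda>t. \<gamma> (1 - t)) t) w = 0)"
    by blast
qed

lemma geodesic_length_reverse:
  assumes "geodesic M \<gamma>" shows "curve_length M (\<lambda>t. \<gamma> (1 - t)) = curve_length M \<gamma>"
proof -
  have "velocity M (\<lambda>t. \<gamma> (1 - t)) 0 = (\<lambda>\<kappa>. - velocity M \<gamma> 1 \<kappa>)"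
    using coord'_reverse[OF assms, of 0] by (auto simp: velocity_def)
  then have "tnorm M (\<gamma> 1) (velocity M (\<lambda>t. \<gamma> (1 - t)) 0) = tnorm M (\<gamma> 1) (velocity M \<gamma> 1)"
    using metric_neg[OF geodesic_velocity_in_tangent_space[OF assms, of 1]] by (simp add: tnorm_def)
  then show ?thesis
    using geodesic_length[OF geodesic_reverse[OF assms]] geodesic_length[OF assms]
      geodesic_constant_speed[OF assms, of 1] by simp
qed

section \<open>Uniqueness of geodesics\<close>

lemma geodesic_coord_nearby:
  assumes "geodesic M \<gamma>" "t \<in> {0..1}" "\<kappa> \<in> charts_at M (\<gamma> t)" "\<delta> > 0" 
  obtains \<epsilon> where "\<epsilon> > 0" "\<And>s. s \<in> {0..1} \<Longrightarrow> dist s t < \<epsilon> \<Longrightarrow> \<kappa> \<in> charts_at M (\<gamma> s) \<and>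
    dist (coord \<kappa> \<gamma> s) (coord \<kappa> \<gamma> t) < \<delta> \<and> dist (coord' \<kappa> \<gamma> s) (coord' \<kappa> \<gamma> t) < \<delta>"
proof -
  have "continuous_on {0..1} \<gamma>" using assms(1) by (simp add: geodesic_def)
  from nearby_in_chart[OF this assms(2,3)] obtain \<epsilon>
    where \<epsilon>: "\<epsilon> > 0" "\<And>s. s \<in> {0..1} \<Longrightarrow> dist s t < \<epsilon> \<Longrightarrow> \<kappa> \<in> charts_at M (\<gamma> s)" by blast
  have "continuous (at t within {0..1}) (coord \<kappa> \<gamma>)"
    by (rule has_vector_derivative_continuous[OF geodesic_coord(1)[OF assms(1-3)]])
  then obtain \<epsilon>1 where \<epsilon>1: "\<epsilon>1 > 0"
    "\<And>s. s \<in> {0..1} \<Longrightarrow> dist s t < \<epsilon>1 \<Longrightarrow> dist (coord \<kappa> \<gamma> s) (coord \<kappa> \<gamma> t) < \<delta>"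
    using assms(4) unfolding continuous_within_eps_delta by blast
  obtain a where "(coord' \<kappa> \<gamma> has_vector_derivative a) (at t within {0..1})"
    using geodesic_coord_acceleration[OF assms(1-3)] by blast
  then have "continuous (at t within {0..1}) (coord' \<kappa> \<gamma>)"
    by (rule has_vector_derivative_continuous)
  then obtain \<epsilon>2 where \<epsilon>2: "\<epsilon>2 > 0"
    "\<And>s. s \<in> {0..1} \<Longrightarrow> dist s t < \<epsilon>2 \<Longrightarrow> dist (coord' \<kappa> \<gamma> s) (coord' \<kappa> \<gamma> t) < \<delta>"
    using assms(4) unfolding continuous_within_eps_delta by blast
  show thesis
  proof (rule that[of "min \<epsilon> (min \<epsilon>1 \<epsilon>2)"])
    show "min \<epsilon> (min \<epsilon>1 \<epsilon>2) > 0" using \<epsilon> \<epsilon>1 \<epsilon>2 by simp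
    fix s :: real assume s: "s \<in> {0..1}" "dist s t < min \<epsilon> (min \<epsilon>1 \<epsilon>2)"
    show "\<kappa> \<in> charts_at M (\<gamma> s) \<and> dist (coord \<kappa> \<gamma> s) (coord \<kappa> \<gamma> t) < \<delta> \<and>
        dist (coord' \<kappa> \<gamma> s) (coord' \<kappa> \<gamma> t) < \<delta>"
      using s by (intro conjI \<epsilon>(2) \<epsilon>1(2) \<epsilon>2(2)) auto
  qed
qed

text \<open>
  Let \<open>u\<close> and \<open>v\<close> be the differences of positions and of velocities in a chart. Since
  accelerations are Lipschitz, the derivative of \<open>(norm u)\<^sup>2 + (norm v)\<^sup>2\<close> is bounded by a multiple of
  this sum, which vanishes at \<open>t0\<close>.
\<close>

lemma geodesic_unique_locally:
  assumes g1: "geodesic M \<gamma>1" and g2: "geodesic M \<gamma>2" and t0: "t0 \<in> {0..1}"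
    and eq: "\<gamma>1 t0 = \<gamma>2 t0" "velocity M \<gamma>1 t0 = velocity M \<gamma>2 t0"
  obtains \<epsilon> where "\<epsilon> > 0" "\<And>s. s \<in> {0..1} \<Longrightarrow> dist s t0 < \<epsilon> \<Longrightarrow>
    \<gamma>1 s = \<gamma>2 s \<and> velocity M \<gamma>1 s = velocity M \<gamma>2 s"
proof -
  obtain \<kappa> where \<kappa>1: "\<kappa> \<in> charts_at M (\<gamma>1 t0)" using ex_chart by blast
  then have \<kappa>2: "\<kappa> \<in> charts_at M (\<gamma>2 t0)" using eq by simp
  interpret coordinate_metric "snd \<kappa> ` fst \<kappa>" "metric_in M \<kappa>"
    by (rule coordinate_metric_chart[OF charts_atD(1)[OF \<kappa>1]])
  define x0 v0 where "x0 = coord \<kappa> \<gamma>1 t0" and "v0 = coord' \<kappa> \<gamma>1 t0"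
  have x0: "coord \<kappa> \<gamma>2 t0 = x0" using eq by (simp add: x0_def)
  have v0: "coord' \<kappa> \<gamma>2 t0 = v0"
    using fun_cong[OF eq(2), of \<kappa>] \<kappa>1 \<kappa>2 by (simp add: velocity_def v0_def)
  \<comment> \<open>Near \<open>t0\<close> both velocities differ from \<open>v0\<close> by less than 1.\<close>
  define R where "R = norm v0 + 1"
  have "x0 \<in> snd \<kappa> ` fst \<kappa>" "R \<ge> 0" using charts_atD(3)[OF \<kappa>1] by (auto simp: x0_def R_def)
  from acceleration_lipschitz[OF this] obtain \<delta> K where K: "\<delta> > 0" "K \<ge> 0"
    "\<And>x y u v a b. x \<in> cball x0 \<delta> \<Longrightarrow> y \<in> cball x0 \<delta> \<Longrightarrow> norm u \<le> R \<Longrightarrow> norm v \<le> R \<Longrightarrow>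
      \<forall>w. metric_in M \<kappa> x a w + christoffel x u u w = 0 \<Longrightarrow>
      \<forall>w. metric_in M \<kappa> y b w + christoffel y v v w = 0 \<Longrightarrow>
      norm (a - b) \<le> K * (norm (x - y) + norm (u - v))" by blast
  have d: "min \<delta> 1 > 0" using K by simp
  obtain \<epsilon>1 where \<epsilon>1: "\<epsilon>1 > 0" "\<And>s. s \<in> {0..1} \<Longrightarrow> dist s t0 < \<epsilon>1 \<Longrightarrow> \<kappa> \<in> charts_at M (\<gamma>1 s) \<and>
      dist (coord \<kappa> \<gamma>1 s) x0 < min \<delta> 1 \<and> dist (coord' \<kappa> \<gamma>1 s) v0 < min \<delta> 1"
    using geodesic_coord_nearby[OF g1 t0 \<kappa>1 d] unfolding x0_def v0_def by blast
  obtain \<epsilon>2 where \<epsilon>2: "\<epsilon>2 > 0" "\<And>s. s \<in> {0..1} \<Longrightarrow> dist s t0 < \<epsilon>2 \<Longrightarrow> \<kappa> \<in> charts_at M (\<gamma>2 s) \<and>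
      dist (coord \<kappa> \<gamma>2 s) x0 < min \<delta> 1 \<and> dist (coord' \<kappa> \<gamma>2 s) v0 < min \<delta> 1"
    using geodesic_coord_nearby[OF g2 t0 \<kappa>2 d] unfolding x0 v0 by blast
  define \<epsilon> where "\<epsilon> = min \<epsilon>1 \<epsilon>2 / 2"
  have \<epsilon>: "\<epsilon> > 0" "\<epsilon> < \<epsilon>1" "\<epsilon> < \<epsilon>2" using \<epsilon>1(1) \<epsilon>2(1) by (auto simp: \<epsilon>_def min_def)
  define a b where "a = max 0 (t0 - \<epsilon>)" and "b = min 1 (t0 + \<epsilon>)"
  have ab: "{a..b} \<subseteq> {0..1}" "t0 \<in> {a..b}" using t0 \<epsilon> by (auto simp: a_def b_def)
  have near: "s \<in> {0..1}" "dist s t0 < \<epsilon>1" "dist s t0 < \<epsilon>2" if "s \<in> {a..b}" for s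
    using that \<epsilon> by (auto simp: a_def b_def dist_real_def)
  have c1: "\<kappa> \<in> charts_at M (\<gamma>1 s)" "coord \<kappa> \<gamma>1 s \<in> cball x0 \<delta>" "norm (coord' \<kappa> \<gamma>1 s) \<le> R"
    if "s \<in> {a..b}" for s
    using \<epsilon>1(2)[OF near(1,2)[OF that]] norm_triangle_sub[of "coord' \<kappa> \<gamma>1 s" v0]
    by (auto simp: R_def dist_norm norm_minus_commute)
  have c2: "\<kappa> \<in> charts_at M (\<gamma>2 s)" "coord \<kappa> \<gamma>2 s \<in> cball x0 \<delta>" "norm (coord' \<kappa> \<gamma>2 s) \<le> R"
    if "s \<in> {a..b}" for s
    using \<epsilon>2(2)[OF near(1,3)[OF that]] norm_triangle_sub[of "coord' \<kappa> \<gamma>2 s" v0]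
    by (auto simp: R_def dist_norm norm_minus_commute)
  define u v where "u s = coord \<kappa> \<gamma>1 s - coord \<kappa> \<gamma>2 s" and "v s = coord' \<kappa> \<gamma>1 s - coord' \<kappa> \<gamma>2 s" for s
  have "\<exists>w. (v has_vector_derivative w) (at s within {a..b}) \<and> norm w \<le> K * (norm (u s) + norm (v s))"
    if s: "s \<in> {a..b}" for s
  proof -
    obtain a1 where a1: "(coord' \<kappa> \<gamma>1 has_vector_derivative a1) (at s within {0..1})"
      "\<forall>w. metric_in M \<kappa> (coord \<kappa> \<gamma>1 s) a1 w + christoffel (coord \<kappa> \<gamma>1 s) (coord' \<kappa> \<gamma>1 s) (coord' \<kappa> \<gamma>1 s) w = 0"
      using geodesic_coord_acceleration[OF g1 near(1)[OF s] c1(1)[OF s]] by blast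
    obtain a2 where a2: "(coord' \<kappa> \<gamma>2 has_vector_derivative a2) (at s within {0..1})"
      "\<forall>w. metric_in M \<kappa> (coord \<kappa> \<gamma>2 s) a2 w + christoffel (coord \<kappa> \<gamma>2 s) (coord' \<kappa> \<gamma>2 s) (coord' \<kappa> \<gamma>2 s) w = 0"
      using geodesic_coord_acceleration[OF g2 near(1)[OF s] c2(1)[OF s]] by blast
    have "(v has_vector_derivative a1 - a2) (at s within {0..1})"
      unfolding v_def by (rule has_vector_derivative_diff[OF a1(1) a2(1)])
    then have "(v has_vector_derivative a1 - a2) (at s within {a..b})"
      by (rule has_vector_derivative_within_subset[OF _ ab(1)])
    moreover have "norm (a1 - a2) \<le> K * (norm (u s) + norm (v s))"
      unfolding u_def v_def by (rule K(3)[OF c1(2)[OF s] c2(2)[OF s] c1(3)[OF s] c2(3)[OF s] a1(2) a2(2)])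
    ultimately show ?thesis by blast
  qed
  then obtain w where w: "\<And>s. s \<in> {a..b} \<Longrightarrow> (v has_vector_derivative w s) (at s within {a..b})"
    "\<And>s. s \<in> {a..b} \<Longrightarrow> norm (w s) \<le> K * (norm (u s) + norm (v s))" by metis
  have u: "(u has_vector_derivative v s) (at s within {a..b})" if s: "s \<in> {a..b}" for s
    unfolding u_def v_def
    by (rule has_vector_derivative_within_subset[OF has_vector_derivative_diff[OF
          geodesic_coord(1)[OF g1 near(1)[OF s] c1(1)[OF s]]
          geodesic_coord(1)[OF g2 near(1)[OF s] c2(1)[OF s]]] ab(1)])
  define \<phi> where "\<phi> s = u s \<bullet> u s + v s \<bullet> v s" for s
  have \<phi>': "(\<phi> has_vector_derivative (2 * (u s \<bullet> v s) + 2 * (v s \<bullet> w s))) (at s within {a..b})"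
    if s: "s \<in> {a..b}" for s
    using u[OF s] w(1)[OF s] unfolding \<phi>_def has_vector_derivative_def
    by (auto intro!: derivative_eq_intros simp: algebra_simps inner_commute)
  have \<phi>_bound: "\<bar>2 * (u s \<bullet> v s) + 2 * (v s \<bullet> w s)\<bar> \<le> (1 + 3 * K) * \<phi> s" if s: "s \<in> {a..b}" for s
  proof -
    define p q where "p = norm (u s)" and "q = norm (v s)"
    have pq: "p \<ge> 0" "q \<ge> 0" by (auto simp: p_def q_def)
    have "\<bar>u s \<bullet> v s\<bar> \<le> p * q" unfolding p_def q_def by (rule Cauchy_Schwarz_ineq2)
    moreover have "\<bar>v s \<bullet> w s\<bar> \<le> q * (K * (p + q))"
      using Cauchy_Schwarz_ineq2[of "v s" "w s"] mult_left_mono[OF w(2)[OF s], of q] pq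
      by (simp add: p_def q_def)
    ultimately have "\<bar>2 * (u s \<bullet> v s) + 2 * (v s \<bullet> w s)\<bar> \<le> 2 * (p * q) + 2 * (q * (K * (p + q)))"
      by linarith
    also have "\<dots> = (1 + K) * (2 * (p * q)) + 2 * K * q\<^sup>2" by (simp add: algebra_simps power2_eq_square)
    also have "\<dots> \<le> (1 + K) * (p\<^sup>2 + q\<^sup>2) + 2 * K * (p\<^sup>2 + q\<^sup>2)"
      using K(2) sum_squares_bound[of p q] by (intro add_mono mult_left_mono) auto
    also have "\<dots> = (1 + 3 * K) * \<phi> s"
      by (simp add: \<phi>_def p_def q_def power2_norm_eq_inner algebra_simps)
    finally show ?thesis .
  qed
  have "u t0 = 0" "v t0 = 0" using x0 v0 by (auto simp: u_def v_def x0_def v0_def)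
  then have "\<phi> t0 = 0" by (simp add: \<phi>_def)
  have zero: "u s = 0 \<and> v s = 0" if s: "s \<in> {a..b}" for s
  proof -
    have "\<phi> s \<le> 0" by (rule gronwall_zero[OF \<phi>' \<phi>_bound ab(2) \<open>\<phi> t0 = 0\<close> s])
    moreover have "u s \<bullet> u s \<ge> 0" "v s \<bullet> v s \<ge> 0" by simp_all
    ultimately have "u s \<bullet> u s = 0" "v s \<bullet> v s = 0" unfolding \<phi>_def by linarith+
    then show ?thesis by simp
  qed
  show thesis
  proof (rule that[OF \<epsilon>(1)])
    fix s :: real assume "s \<in> {0..1}" "dist s t0 < \<epsilon>"
    then have s: "s \<in> {a..b}" by (auto simp: a_def b_def dist_real_def)
    have c: "coord \<kappa> \<gamma>1 s = coord \<kappa> \<gamma>2 s" and c': "coord' \<kappa> \<gamma>1 s = coord' \<kappa> \<gamma>2 s"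
      using zero[OF s] unfolding u_def v_def by simp_all
    have p: "\<gamma>1 s = \<gamma>2 s"
      using chart_inv_left[OF c1(1)[OF s]] chart_inv_left[OF c2(1)[OF s]] c unfolding comp_def by metis
    have "velocity M \<gamma>1 s = tvec_of_coord M (\<gamma>1 s) \<kappa> (coord' \<kappa> \<gamma>1 s)"
      by (rule geodesic_velocity[OF g1 near(1)[OF s] c1(1)[OF s]])
    also have "\<dots> = tvec_of_coord M (\<gamma>2 s) \<kappa> (coord' \<kappa> \<gamma>2 s)" by (simp only: p c')
    also have "\<dots> = velocity M \<gamma>2 s"
      by (rule geodesic_velocity[OF g2 near(1)[OF s] c2(1)[OF s], symmetric])
    finally show "\<gamma>1 s = \<gamma>2 s \<and> velocity M \<gamma>1 s = velocity M \<gamma>2 s" using p by simp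
  qed
qed

text \<open>
  Together with the preceding lemma this shows that agreement of position and velocity is an open
  and closed condition. Different positions stay apart by the Hausdorff property; for equal positions
  and different velocities one chart serves both curves, in which the velocities are continuous.
\<close>

lemma geodesic_differ_locally:
  assumes g1: "geodesic M \<gamma>1" and g2: "geodesic M \<gamma>2" and t0: "t0 \<in> {0..1}"
    and ne: "\<not> (\<gamma>1 t0 = \<gamma>2 t0 \<and> velocity M \<gamma>1 t0 = velocity M \<gamma>2 t0)"
  obtains \<epsilon> where "\<epsilon> > 0" "\<And>s. s \<in> {0..1} \<Longrightarrow> dist s t0 < \<epsilon> \<Longrightarrow>
    \<not> (\<gamma>1 s = \<gamma>2 s \<and> velocity M \<gamma>1 s = velocity M \<gamma>2 s)"
proof (cases "\<gamma>1 t0 = \<gamma>2 t0")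
  case True
  obtain \<kappa> where \<kappa>1: "\<kappa> \<in> charts_at M (\<gamma>1 t0)" using ex_chart by blast
  then have \<kappa>2: "\<kappa> \<in> charts_at M (\<gamma>2 t0)" using True by simp
  define \<delta> where "\<delta> = dist (coord' \<kappa> \<gamma>1 t0) (coord' \<kappa> \<gamma>2 t0) / 2"
  have "coord' \<kappa> \<gamma>1 t0 \<noteq> coord' \<kappa> \<gamma>2 t0"
  proof
    assume "coord' \<kappa> \<gamma>1 t0 = coord' \<kappa> \<gamma>2 t0"
    then have "velocity M \<gamma>1 t0 = velocity M \<gamma>2 t0"
      unfolding geodesic_velocity[OF g1 t0 \<kappa>1] geodesic_velocity[OF g2 t0 \<kappa>2] True by (rule arg_cong)
    then show False using ne True by blast
  qed
  then have \<delta>: "\<delta> > 0" by (simp add: \<delta>_def)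
  obtain \<epsilon>1 where \<epsilon>1: "\<epsilon>1 > 0" "\<And>s. s \<in> {0..1} \<Longrightarrow> dist s t0 < \<epsilon>1 \<Longrightarrow> \<kappa> \<in> charts_at M (\<gamma>1 s) \<and>
      dist (coord \<kappa> \<gamma>1 s) (coord \<kappa> \<gamma>1 t0) < \<delta> \<and>
      dist (coord' \<kappa> \<gamma>1 s) (coord' \<kappa> \<gamma>1 t0) < \<delta>"
    using geodesic_coord_nearby[OF g1 t0 \<kappa>1 \<delta>] by blast
  obtain \<epsilon>2 where \<epsilon>2: "\<epsilon>2 > 0" "\<And>s. s \<in> {0..1} \<Longrightarrow> dist s t0 < \<epsilon>2 \<Longrightarrow> \<kappa> \<in> charts_at M (\<gamma>2 s) \<and>
      dist (coord \<kappa> \<gamma>2 s) (coord \<kappa> \<gamma>2 t0) < \<delta> \<and>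
      dist (coord' \<kappa> \<gamma>2 s) (coord' \<kappa> \<gamma>2 t0) < \<delta>"
    using geodesic_coord_nearby[OF g2 t0 \<kappa>2 \<delta>] by blast
  show thesis
  proof (rule that[of "min \<epsilon>1 \<epsilon>2"])
    show "min \<epsilon>1 \<epsilon>2 > 0" using \<epsilon>1 \<epsilon>2 by simp
    fix s :: real assume s: "s \<in> {0..1}" "dist s t0 < min \<epsilon>1 \<epsilon>2"
    show "\<not> (\<gamma>1 s = \<gamma>2 s \<and> velocity M \<gamma>1 s = velocity M \<gamma>2 s)"
    proof
      assume "\<gamma>1 s = \<gamma>2 s \<and> velocity M \<gamma>1 s = velocity M \<gamma>2 s"
      then have "velocity M \<gamma>1 s \<kappa> = velocity M \<gamma>2 s \<kappa>" by simp
      moreover have "velocity M \<gamma>1 s \<kappa> = coord' \<kappa> \<gamma>1 s" "velocity M \<gamma>2 s \<kappa> = coord' \<kappa> \<gamma>2 s"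
        using \<epsilon>1(2)[of s] \<epsilon>2(2)[of s] s unfolding velocity_def by simp_all
      ultimately have e: "coord' \<kappa> \<gamma>1 s = coord' \<kappa> \<gamma>2 s" by (simp only:)
      have "dist (coord' \<kappa> \<gamma>1 s) (coord' \<kappa> \<gamma>1 t0) < \<delta>"
        "dist (coord' \<kappa> \<gamma>2 s) (coord' \<kappa> \<gamma>2 t0) < \<delta>"
        using \<epsilon>1(2)[of s] \<epsilon>2(2)[of s] s by simp_all
      then show False
        using dist_triangle3[of "coord' \<kappa> \<gamma>1 t0" "coord' \<kappa> \<gamma>2 t0" "coord' \<kappa> \<gamma>2 s"]
        unfolding \<delta>_def e by linarith
    qed
  qed
next
  case False
  from hausdorff[OF this] obtain U V
    where UV: "open U" "open V" "\<gamma>1 t0 \<in> U" "\<gamma>2 t0 \<in> V" "U \<inter> V = {}" by blast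
  have near: "\<exists>\<epsilon>>0. \<forall>s\<in>{0..1}. dist s t0 < \<epsilon> \<longrightarrow> \<gamma> s \<in> W"
    if "geodesic M \<gamma>" "open W" "\<gamma> t0 \<in> W" for \<gamma> W
  proof -
    have "continuous_on {0..1} \<gamma>" using that(1) by (simp add: geodesic_def)
    then have "openin (top_of_set {0..1}) ({0..1} \<inter> \<gamma> -` W)"
      using that(2) by (rule continuous_openin_preimage_gen)
    moreover have "t0 \<in> {0..1} \<inter> \<gamma> -` W" using that(3) t0 by simp
    ultimately obtain \<epsilon> where "\<epsilon> > 0" "\<And>s. s \<in> {0..1} \<Longrightarrow> dist s t0 < \<epsilon> \<Longrightarrow> \<gamma> s \<in> W"
      unfolding openin_euclidean_subtopology_iff by blast
    then show ?thesis by blast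
  qed
  obtain \<epsilon>1 where \<epsilon>1: "\<epsilon>1 > 0" "\<And>s. s \<in> {0..1} \<Longrightarrow> dist s t0 < \<epsilon>1 \<Longrightarrow> \<gamma>1 s \<in> U"
    using near[OF g1 UV(1,3)] by blast
  obtain \<epsilon>2 where \<epsilon>2: "\<epsilon>2 > 0" "\<And>s. s \<in> {0..1} \<Longrightarrow> dist s t0 < \<epsilon>2 \<Longrightarrow> \<gamma>2 s \<in> V"
    using near[OF g2 UV(2,4)] by blast
  show thesis
  proof (rule that[of "min \<epsilon>1 \<epsilon>2"])
    show "min \<epsilon>1 \<epsilon>2 > 0" using \<epsilon>1 \<epsilon>2 by simp
    fix s :: real assume s: "s \<in> {0..1}" "dist s t0 < min \<epsilon>1 \<epsilon>2"
    then have "\<gamma>1 s \<in> U" "\<gamma>2 s \<in> V" using \<epsilon>1(2) \<epsilon>2(2) by auto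
    then show "\<not> (\<gamma>1 s = \<gamma>2 s \<and> velocity M \<gamma>1 s = velocity M \<gamma>2 s)" using UV(5) by auto
  qed
qed

lemma geodesic_unique:
  assumes g1: "geodesic M \<gamma>1" and g2: "geodesic M \<gamma>2"
    and eq: "\<gamma>1 0 = \<gamma>2 0" "velocity M \<gamma>1 0 = velocity M \<gamma>2 0" and t: "t \<in> {0..1}"
  shows "\<gamma>1 t = \<gamma>2 t"
proof -
  define P where "P s \<longleftrightarrow> \<gamma>1 s = \<gamma>2 s \<and> velocity M \<gamma>1 s = velocity M \<gamma>2 s" for s
  have "P 0 = P t"
  proof (rule connected_equivalence_relation[where R = "\<lambda>x y. P x = P y" and S = "{0..1}"])
    fix s :: real assume s: "s \<in> {0..1}"
    obtain \<epsilon> where \<epsilon>: "\<epsilon> > 0" "\<And>r. r \<in> {0..1} \<Longrightarrow> dist r s < \<epsilon> \<Longrightarrow> P r = P s"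
    proof (cases "P s")
      case True
      then have eq_s: "\<gamma>1 s = \<gamma>2 s" "velocity M \<gamma>1 s = velocity M \<gamma>2 s" by (simp_all only: P_def)
      show thesis
      proof (rule geodesic_unique_locally[OF g1 g2 s eq_s])
        fix \<epsilon> :: real assume \<epsilon>: "\<epsilon> > 0"
          "\<And>r. r \<in> {0..1} \<Longrightarrow> dist r s < \<epsilon> \<Longrightarrow> \<gamma>1 r = \<gamma>2 r \<and> velocity M \<gamma>1 r = velocity M \<gamma>2 r"
        show thesis by (rule that[OF \<epsilon>(1)]) (use \<epsilon>(2) True in \<open>simp only: P_def simp_thms\<close>)
      qed
    next
      case False
      show thesis
      proof (rule geodesic_differ_locally[OF g1 g2 s False[unfolded P_def]])
        fix \<epsilon> :: real assume \<epsilon>: "\<epsilon> > 0"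
          "\<And>r. r \<in> {0..1} \<Longrightarrow> dist r s < \<epsilon> \<Longrightarrow> \<not> (\<gamma>1 r = \<gamma>2 r \<and> velocity M \<gamma>1 r = velocity M \<gamma>2 r)"
        show thesis by (rule that[OF \<epsilon>(1)]) (use \<epsilon>(2) False in \<open>simp only: P_def\<close>)
      qed
    qed
    have "openin (top_of_set {0..1}) ({0..1} \<inter> ball s \<epsilon>)" by (simp add: openin_open_Int)
    moreover have "s \<in> {0..1} \<inter> ball s \<epsilon>" using s \<epsilon>(1) by simp
    moreover have "P s = P x" if "x \<in> {0..1} \<inter> ball s \<epsilon>" for x
      using \<epsilon>(2)[of x] that by (simp add: dist_commute)
    ultimately show "\<exists>T. openin (top_of_set {0..1}) T \<and> s \<in> T \<and> (\<forall>x\<in>T. P s = P x)" by blast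
  qed (use t in simp_all)
  then show ?thesis using eq unfolding P_def by blast
qed

section \<open>The exponential map on a strongly convex set\<close>

lemma riem_exp_geodesic:
  assumes "geodesic M \<gamma>" "\<gamma> 0 = m"
  shows "riem_exp M m (velocity M \<gamma> 0) = \<gamma> 1"
  unfolding riem_exp_def
proof (rule the_equality)
  show "\<exists>\<gamma>'. geodesic M \<gamma>' \<and> \<gamma>' 0 = m \<and> velocity M \<gamma>' 0 = velocity M \<gamma> 0 \<and> \<gamma>' 1 = \<gamma> 1"
    using assms by blast
  fix p assume "\<exists>\<gamma>'. geodesic M \<gamma>' \<and> \<gamma>' 0 = m \<and> velocity M \<gamma>' 0 = velocity M \<gamma> 0 \<and> \<gamma>' 1 = p"
  then obtain \<gamma>' where g: "geodesic M \<gamma>'" "\<gamma>' 0 = m" "velocity M \<gamma>' 0 = velocity M \<gamma> 0" "\<gamma>' 1 = p" by blast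
  show "p = \<gamma> 1" using geodesic_unique[OF g(1) assms(1), of 1] g assms by simp
qed

text \<open>
  Strong convexity identifies shortest geodesics on the unit interval only; the one-sided derivative
  at its end points sees nothing else.
\<close>

lemma velocity_cong:
  assumes "\<And>t. t \<in> {0..1} \<Longrightarrow> \<gamma>1 t = \<gamma>2 t" "t \<in> {0..1}"
  shows "velocity M \<gamma>1 t = velocity M \<gamma>2 t"
proof
  fix \<kappa>
  have imp: "(coord \<kappa> \<gamma> has_vector_derivative d) (at t within {0..1})"
    if "\<And>t. t \<in> {0..1} \<Longrightarrow> \<gamma> t = \<gamma>' t" "(coord \<kappa> \<gamma>' has_vector_derivative d) (at t within {0..1})" for \<gamma> \<gamma>' d
    by (rule has_vector_derivative_transform[OF assms(2) _ that(2)]) (simp add: that(1))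
  have "(coord \<kappa> \<gamma>1 has_vector_derivative d) (at t within {0..1}) \<longleftrightarrow>
      (coord \<kappa> \<gamma>2 has_vector_derivative d) (at t within {0..1})" for d
    using imp[of \<gamma>1 \<gamma>2 d] imp[of \<gamma>2 \<gamma>1 d] assms(1) by auto
  then show "velocity M \<gamma>1 t \<kappa> = velocity M \<gamma>2 t \<kappa>"
    by (simp add: velocity_def vector_derivative_def assms(1)[OF assms(2)])
qed

text \<open>
  Let \<open>X\<close> have the end point \<open>p\<close>. The geodesic with initial velocity \<open>X\<close>, run backwards, leads
  from \<open>p\<close> to \<open>m\<close> and has length \<open>tnorm M m X\<close>. So it is a shortest geodesic from \<open>p\<close> to
  \<open>m\<close>, of which there is exactly one.
\<close>

lemma bij_betw_riem_exp:
  assumes C: "strongly_convex M C" "m \<in> C"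
  shows "bij_betw (riem_exp M m) (log_range M C m) C"
  unfolding bij_betw_def
proof
  have rev: "\<exists>\<gamma>. geodesic M \<gamma> \<and> \<gamma> 0 = m \<and> velocity M \<gamma> 0 = X \<and>
      shortest_geodesic M (riem_exp M m X) m (\<lambda>t. \<gamma> (1 - t))" if "X \<in> log_range M C m" for X
  proof -
    obtain \<gamma> where g: "geodesic M \<gamma>" "\<gamma> 0 = m" "velocity M \<gamma> 0 = X"
      using \<open>X \<in> log_range M C m\<close> by (auto simp: log_range_def exp_domain_def)
    have "\<gamma> 1 = riem_exp M m X" using riem_exp_geodesic[OF g(1,2)] g(3) by simp
    moreover have "curve_length M (\<lambda>t. \<gamma> (1 - t)) = riem_dist M (riem_exp M m X) m"
      using geodesic_length_reverse[OF g(1)] geodesic_length[OF g(1)] g that by (simp add: log_range_def)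
    ultimately show ?thesis using g geodesic_reverse[OF g(1)] by (auto simp: shortest_geodesic_def)
  qed
  show "inj_on (riem_exp M m) (log_range M C m)"
  proof (rule inj_onI)
    fix X Y assume X: "X \<in> log_range M C m" and Y: "Y \<in> log_range M C m"
      and eq: "riem_exp M m X = riem_exp M m Y"
    obtain \<gamma>1 where 1: "velocity M \<gamma>1 0 = X" "shortest_geodesic M (riem_exp M m X) m (\<lambda>t. \<gamma>1 (1 - t))"
      using rev[OF X] by blast
    obtain \<gamma>2 where 2: "velocity M \<gamma>2 0 = Y" "shortest_geodesic M (riem_exp M m X) m (\<lambda>t. \<gamma>2 (1 - t))"
      using rev[OF Y] eq by auto
    have "riem_exp M m X \<in> C" using X by (simp add: log_range_def)
    then obtain \<gamma> where "\<And>\<gamma>'. shortest_geodesic M (riem_exp M m X) m \<gamma>' \<Longrightarrow> \<forall>t\<in>{0..1}. \<gamma>' t = \<gamma> t"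
      using C unfolding strongly_convex_def by blast
    from this[OF 1(2)] this[OF 2(2)] have "\<gamma>1 (1 - t) = \<gamma>2 (1 - t)" if "t \<in> {0..1}" for t
      using that by simp
    from this[of "1 - _"] have "\<gamma>1 t = \<gamma>2 t" if "t \<in> {0..1}" for t using that by simp
    then have "velocity M \<gamma>1 0 = velocity M \<gamma>2 0" by (rule velocity_cong) auto
    then show "X = Y" using 1 2 by simp
  qed
  show "riem_exp M m ` log_range M C m = C"
  proof
    show "riem_exp M m ` log_range M C m \<subseteq> C" by (auto simp: log_range_def)
    show "C \<subseteq> riem_exp M m ` log_range M C m"
    proof
      fix p assume p: "p \<in> C"
      then obtain \<gamma> where "shortest_geodesic M p m \<gamma>" using C unfolding strongly_convex_def by blast
      then have g: "geodesic M \<gamma>" "\<gamma> 0 = p" "\<gamma> 1 = m" "curve_length M \<gamma> = riem_dist M p m"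
        by (auto simp: shortest_geodesic_def)
      define \<rho> where "\<rho> t = \<gamma> (1 - t)" for t
      have \<rho>: "geodesic M \<rho>" "\<rho> 0 = m" "\<rho> 1 = p" "curve_length M \<rho> = riem_dist M p m"
        using geodesic_reverse[OF g(1)] geodesic_length_reverse[OF g(1)] g unfolding \<rho>_def by simp_all
      have e: "riem_exp M m (velocity M \<rho> 0) = p" using riem_exp_geodesic[OF \<rho>(1,2)] \<rho>(3) by simp
      have "velocity M \<rho> 0 \<in> log_range M C m"
        using geodesic_velocity_in_tangent_space[OF \<rho>(1), of 0] \<rho> geodesic_length[OF \<rho>(1)] p
        by (auto simp: log_range_def exp_domain_def e)
      then show "p \<in> riem_exp M m ` log_range M C m" using e by blast
    qed
  qed
qed

section \<open>Affine minorants on the tangent space and the biconjugate\<close>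

text \<open>
  By this estimate, lower semicontinuity with respect to \<^const>\<open>tnorm\<close> implies lower semicontinuity
  in coordinates.
\<close>

lemma tnorm_tvec_of_coord_bounded:
  assumes "\<kappa> \<in> charts_at M m"
  obtains B where "B > 0" "\<And>u. tnorm M m (tvec_of_coord M m \<kappa> u) \<le> B * norm u"
proof -
  interpret coordinate_metric "snd \<kappa> ` fst \<kappa>" "metric_in M \<kappa>"
    by (rule coordinate_metric_chart[OF charts_atD(1)[OF assms]])
  have "bilinear (metric_in M \<kappa> (snd \<kappa> m))"
    using charts_atD(3)[OF assms] by (simp add: bilinear_def linear_left linear_right)
  then obtain B where B: "B > 0" "\<And>u v. norm (metric_in M \<kappa> (snd \<kappa> m) u v) \<le> B * norm u * norm v"
    using bilinear_bounded_pos by blast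
  show thesis
  proof (rule that[of "sqrt B"])
    fix u
    have "metric M m (tvec_of_coord M m \<kappa> u) (tvec_of_coord M m \<kappa> u) \<le> B * (norm u)\<^sup>2"
      using B(2)[of u u] by (simp add: metric_in_chart[OF assms] power2_eq_square mult.assoc)
    then have "tnorm M m (tvec_of_coord M m \<kappa> u) \<le> sqrt (B * (norm u)\<^sup>2)"
      unfolding tnorm_def by (rule real_sqrt_le_mono)
    then show "tnorm M m (tvec_of_coord M m \<kappa> u) \<le> sqrt B * norm u" by (simp add: real_sqrt_mult)
  qed (use B in simp)
qed

lemma tangent_affine_minorant:
  assumes conv: "convex_on_tangent M m f" and lsc: "lsc_on_tangent M m f"
    and proper: "\<And>X. X \<in> tangent_space M m \<Longrightarrow> f X \<noteq> -\<infinity>" "X1 \<in> tangent_space M m" "f X1 \<noteq> \<infinity>"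
    and r: "X0 \<in> tangent_space M m" "ereal r < f X0"
  obtains \<xi> \<beta> where "\<xi> \<in> cotangent_space M m"
    "\<And>X. X \<in> tangent_space M m \<Longrightarrow> ereal (\<xi> X - \<beta>) \<le> f X" "r < \<xi> X0 - \<beta>"
proof -
  obtain \<kappa> where \<kappa>: "\<kappa> \<in> charts_at M m" using ex_chart by blast
  define T where "T = tvec_of_coord M m \<kappa>"
  have T: "T u \<in> tangent_space M m" "T u \<kappa> = u" for u
    using tvec_of_coord_in_tangent_space[OF \<kappa>] tvec_of_coord_same[OF \<kappa>] by (auto simp: T_def)
  have T_inv: "T (X \<kappa>) = X" if "X \<in> tangent_space M m" for X
    using tvec_of_coord_inverse[OF \<kappa> that] by (simp add: T_def)
  have T_lin: "T (a *\<^sub>R u + b *\<^sub>R v) = lincomb a (T u) b (T v)" for a b u v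
    using tvec_of_coord_lincomb[OF \<kappa>] by (simp add: T_def)
  obtain B where B: "B > 0" "\<And>u. tnorm M m (T u) \<le> B * norm u"
    using tnorm_tvec_of_coord_bounded[OF \<kappa>] unfolding T_def by blast
  obtain \<xi> \<beta> where mi: "\<And>y. ereal (\<xi> \<bullet> y - \<beta>) \<le> f (T y)" "r < \<xi> \<bullet> X0 \<kappa> - \<beta>"
  proof (rule affine_minorant[where g = "\<lambda>u. f (T u)" and ?x1.0 = "X1 \<kappa>" and ?x0.0 = "X0 \<kappa>" and r = r])
    fix x y t assume "t \<in> {0<..<1::real}"
    then show "f (T ((1 - t) *\<^sub>R x + t *\<^sub>R y)) \<le> ereal (1 - t) * f (T x) + ereal t * f (T y)"
      using conv T unfolding convex_on_tangent_def T_lin by blast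
  next
    fix x a assume "a < f (T x)"
    then obtain \<delta> where \<delta>: "\<delta> > 0" "\<And>Y. Y \<in> tangent_space M m \<Longrightarrow>
        tnorm M m (lincomb 1 Y (-1) (T x)) < \<delta> \<Longrightarrow> a < f Y"
      using lsc T(1) unfolding lsc_on_tangent_def by blast
    have "a < f (T y)" if "dist y x < \<delta> / B" for y
    proof (rule \<delta>(2)[OF T(1)])
      have "tnorm M m (lincomb 1 (T y) (-1) (T x)) = tnorm M m (T (y - x))"
        using T_lin[of 1 y "-1" x] by simp
      also have "\<dots> \<le> B * norm (y - x)" by (rule B(2))
      also have "\<dots> < \<delta>" using that B(1) by (simp add: dist_norm field_simps)
      finally show "tnorm M m (lincomb 1 (T y) (-1) (T x)) < \<delta>" .
    qed
    then show "\<exists>\<delta>>0. \<forall>y. dist y x < \<delta> \<longrightarrow> a < f (T y)"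
      using \<delta>(1) B(1) by (intro exI[of _ "\<delta> / B"]) auto
  next
    show "f (T x) \<noteq> -\<infinity>" for x using proper(1) T by blast
    show "f (T (X1 \<kappa>)) \<noteq> \<infinity>" using proper(2,3) T_inv by simp
    show "ereal r < f (T (X0 \<kappa>))" using r T_inv by simp
  qed blast
  show thesis
  proof (rule that[of "\<lambda>X. if X \<in> tangent_space M m then \<xi> \<bullet> X \<kappa> else 0" \<beta>])
    have "lincomb a X b Y \<in> tangent_space M m" if "X \<in> tangent_space M m" "Y \<in> tangent_space M m" for a b X Y
      using T(1)[of "a *\<^sub>R X \<kappa> + b *\<^sub>R Y \<kappa>"] that by (simp add: T_lin T_inv)
    then show "(\<lambda>X. if X \<in> tangent_space M m then \<xi> \<bullet> X \<kappa> else 0) \<in> cotangent_space M m"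
      by (auto simp: cotangent_space_def lincomb_def inner_add_right)
    show "ereal ((if X \<in> tangent_space M m then \<xi> \<bullet> X \<kappa> else 0) - \<beta>) \<le> f X" if "X \<in> tangent_space M m" for X
      using mi(1)[of "X \<kappa>"] that by (simp add: T_inv)
    show "r < (if X0 \<in> tangent_space M m then \<xi> \<bullet> X0 \<kappa> else 0) - \<beta>" using mi(2) r by simp
  qed
qed

end

theorem theorem3p13:
  fixes M :: "('m::{t2_space,second_countable_topology}, 'e::euclidean_space) riem_structure"
    and C :: "'m set" and m :: 'm and F :: "'m \<Rightarrow> ereal"
  assumes "connected_riemannian_manifold M"
    and "strongly_convex M C" and "m \<in> C"
    and "proper_on C F"
    and "lsc_on_tangent M m (tangent_pullback M C m F)"
    and "convex_on_tangent M m (tangent_pullback M C m F)"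
  shows "(\<forall>p\<in>C. F p = fenchel_biconjugate M C m F p) \<and>
    proper_on (cotangent_space M m) (fenchel_conjugate M C m F)"
proof -
  interpret riemannian_manifold M by standard (rule assms(1))
  let ?L = "log_range M C m" and ?f = "tangent_pullback M C m F" and ?F' = "fenchel_conjugate M C m F"
  have bij: "inj_on (riem_exp M m) ?L" "riem_exp M m ` ?L = C"
    using bij_betw_riem_exp[OF assms(2,3)] by (auto simp: bij_betw_def)
  have log: "riem_log M C m p \<in> ?L" "riem_exp M m (riem_log M C m p) = p" if "p \<in> C" for p
    using the_inv_into_into[OF bij(1), of p ?L] f_the_inv_into_f[OF bij(1), of p] bij(2) that
    by (auto simp: riem_log_def)
  have L: "X \<in> tangent_space M m" "riem_exp M m X \<in> C" if "X \<in> ?L" for X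
    using that by (auto simp: log_range_def exp_domain_def)
  have F: "F p \<noteq> -\<infinity>" if "p \<in> C" for p using assms(4) that by (simp add: proper_on_def)
  obtain p1 where p1: "p1 \<in> C" "F p1 \<noteq> \<infinity>" using assms(4) by (auto simp: proper_on_def)
  have minorant: "\<exists>\<xi>\<in>cotangent_space M m. \<exists>\<beta>. ?F' \<xi> \<le> ereal \<beta> \<and> r < \<xi> (riem_log M C m p) - \<beta>"
    if p: "p \<in> C" and r: "ereal r < F p" for p r
  proof -
    obtain \<xi> \<beta> where \<xi>: "\<xi> \<in> cotangent_space M m"
      "\<And>X. X \<in> tangent_space M m \<Longrightarrow> ereal (\<xi> X - \<beta>) \<le> ?f X" "r < \<xi> (riem_log M C m p) - \<beta>"
    proof (rule tangent_affine_minorant[OF assms(6,5)])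
      show "?f X \<noteq> -\<infinity>" if "X \<in> tangent_space M m" for X
        using F L by (simp add: tangent_pullback_def)
      show "riem_log M C m p1 \<in> tangent_space M m" "riem_log M C m p \<in> tangent_space M m"
        using log L p p1 by auto
      show "?f (riem_log M C m p1) \<noteq> \<infinity>" using log[OF p1(1)] p1 by (simp add: tangent_pullback_def)
      show "ereal r < ?f (riem_log M C m p)" using log[OF p] r by (simp add: tangent_pullback_def)
    qed blast
    have "?F' \<xi> \<le> ereal \<beta>" unfolding fenchel_conjugate_def
    proof (rule SUP_least)
      fix X assume X: "X \<in> ?L"
      then have "ereal (\<xi> X - \<beta>) \<le> F (riem_exp M m X)" using \<xi>(2) L by (metis tangent_pullback_def)
      then show "ereal (\<xi> X) - F (riem_exp M m X) \<le> ereal \<beta>"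
        by (cases "F (riem_exp M m X)") auto
    qed
    then show ?thesis using \<xi> by blast
  qed
  have young: "ereal (\<xi> (riem_log M C m p)) - F p \<le> ?F' \<xi>" if "p \<in> C" for \<xi> p
    unfolding fenchel_conjugate_def
    by (rule SUP_upper2[OF log(1)[OF that]]) (simp add: log(2)[OF that])
  have "proper_on (cotangent_space M m) ?F'"
    unfolding proper_on_def
  proof
    \<comment> \<open>Any real number below \<open>F p1\<close> yields a minorant, that is, a functional with finite conjugate.\<close>
    obtain s1 where s1: "F p1 = ereal s1" using p1 F by (cases "F p1") auto
    then have "ereal (s1 - 1) < F p1" by simp
    from minorant[OF p1(1) this] show "\<exists>\<xi>\<in>cotangent_space M m. ?F' \<xi> \<noteq> \<infinity>" by force
    show "\<forall>\<xi>\<in>cotangent_space M m. ?F' \<xi> \<noteq> -\<infinity>"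
    proof
      fix \<xi> show "?F' \<xi> \<noteq> -\<infinity>" using young[OF p1(1), of \<xi>] s1 by auto
    qed
  qed
  moreover have "F p = fenchel_biconjugate M C m F p" if p: "p \<in> C" for p
  proof (rule antisym)
    show "fenchel_biconjugate M C m F p \<le> F p"
      unfolding fenchel_biconjugate_def
    proof (rule SUP_least)
      fix \<xi>
      show "ereal (\<xi> (riem_log M C m p)) - ?F' \<xi> \<le> F p"
        using young[OF p, of \<xi>] F[OF p] by (cases "F p"; cases "?F' \<xi>") auto
    qed
    show "F p \<le> fenchel_biconjugate M C m F p"
    proof (rule dense_le)
      fix z assume z: "z < F p"
      then obtain r where r: "z < ereal r" "ereal r < F p" using ereal_dense2 by blast
      from minorant[OF p r(2)] obtain \<xi> \<beta>
        where \<xi>: "\<xi> \<in> cotangent_space M m" "?F' \<xi> \<le> ereal \<beta>" "r < \<xi> (riem_log M C m p) - \<beta>" by blast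
      have "ereal r \<le> ereal (\<xi> (riem_log M C m p)) - ereal \<beta>" using \<xi>(3) by simp
      also have "\<dots> \<le> ereal (\<xi> (riem_log M C m p)) - ?F' \<xi>" using \<xi>(2) by (intro ereal_minus_mono) auto
      also have "\<dots> \<le> fenchel_biconjugate M C m F p"
        unfolding fenchel_biconjugate_def by (rule SUP_upper[OF \<xi>(1)])
      finally show "z \<le> fenchel_biconjugate M C m F p" using r(1) by simp
    qed
  qed
  ultimately show ?thesis by blast
qed

end
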